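(* Let $(A_{1},k_{1})\subseteq(A_{2},k_{2})$ and $(B_{1},l_{1})\subseteq(B_{2},l_{2})$ be two extensions of Cohen rings, and suppose that $k_{2}/k_{1}$ is separable. Let $\phi=(\phi_{A},\phi_{k}):(A_{1},k_{1})\to(B_{1},l_{1})$ be a morphism, and let $\Phi_{k}:k_{2}\to l_{2}$ be a field embedding extending $\phi_{k}$ such that $l_{2}/\Phi_{k}(k_{2})$ is separable. Let $\boldsymbol{\beta}$ be a $p$-basis of $k_{2}$ over $k_{1}$, and let $s_{A}:\boldsymbol{\beta}\to A_{2}$ and $s_{B}:\Phi_{k}(\boldsymbol{\beta})\to B_{2}$ be choices of representatives. Then there exists a unique morphism of Cohen rings $\Phi=(\Phi_{A},\Phi_{k}):(A_{2},k_{2})\to(B_{2},l_{2})$ whose residue field component is the given $\Phi_k$, which respects $s_{A}$ and $s_{B}$ (i.e. $\Phi_A(s_A(\beta))=s_B(\Phi_k(\beta))$ for all $\beta\in\boldsymbol\beta$), and which extends $\phi$ (i.e. $\Phi_A|_{A_1}=\phi_A$).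
   Context: $p$ is a fixed prime. A Cohen ring is a pair $(A,k)$ where $A$ is a commutative Noetherian local ring, complete in its local ($\mathfrak m$-adic) topology, with maximal ideal $\mathfrak m_A=pA$, and $k=A/\mathfrak m_A$ with residue map $\mathrm{res}$. A morphism $(A,k)\to(B,l)$ of such rings is a pair $(\phi_A,\phi_k)$ of ring homomorphisms $\phi_A:A\to B$, $\phi_k:k\to l$ with $\phi_A^{-1}(\mathfrak m_B)=\mathfrak m_A$ and $\phi_k\circ\mathrm{res}=\mathrm{res}\circ\phi_A$. We write $(A_1,k_1)\subseteq(A_2,k_2)$ if $A_1$ is a subring of $A_2$, $k_1$ a subfield of $k_2$, and the inclusions form a morphism. A subset $\boldsymbol\beta\subseteq k_2$ is a $p$-basis of $k_2$ over $k_1$ if $k_2=k_2^p k_1(\boldsymbol\beta)$ and $[k_2^pk_1(\beta_1,\dots,\beta_r):k_2^pk_1]=p^r$ for all pairwise distinct $\beta_1,\dots,\beta_r\in\boldsymbol\beta$ (equivalently, when $k_2/k_1$ is separable, $\boldsymbol\beta$ together with any $p$-basis of $k_1$ is a $p$-basis of $k_2$, disjointly). A choice of representatives $s:X\to A$ for a subset $X$ of the residue field satisfies $\mathrm{res}(s(x))=x$. *)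

theory Defs
  imports "HOL-Algebra.Algebra"
begin

definition pelem :: "nat \<Rightarrow> ('a, 'm) ring_scheme \<Rightarrow> 'a" where
  "pelem p A = [p] \<cdot>\<^bsub>A\<^esub> \<one>\<^bsub>A\<^esub>"

definition padic_ideal :: "nat \<Rightarrow> ('a, 'm) ring_scheme \<Rightarrow> nat \<Rightarrow> 'a set" where
  "padic_ideal p A n = PIdl\<^bsub>A\<^esub> (pelem p A [^]\<^bsub>A\<^esub> n)"

definition max_ideal :: "nat \<Rightarrow> ('a, 'm) ring_scheme \<Rightarrow> 'a set" where
  "max_ideal p A = PIdl\<^bsub>A\<^esub> (pelem p A)"

definition padic_complete :: "nat \<Rightarrow> ('a, 'm) ring_scheme \<Rightarrow> bool" where
  "padic_complete p A \<longleftrightarrow>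
     (\<forall>x\<in>carrier A. (\<forall>n. x \<in> padic_ideal p A n) \<longrightarrow> x = \<zero>\<^bsub>A\<^esub>) \<and>
     (\<forall>f::nat \<Rightarrow> 'a. (\<forall>n. f n \<in> carrier A) \<longrightarrow>
          (\<forall>N. \<exists>M. \<forall>m\<ge>M. \<forall>n\<ge>M. f m \<ominus>\<^bsub>A\<^esub> f n \<in> padic_ideal p A N) \<longrightarrow>
          (\<exists>y\<in>carrier A. \<forall>N. \<exists>M. \<forall>n\<ge>M. f n \<ominus>\<^bsub>A\<^esub> y \<in> padic_ideal p A N))"

definition cohen_ring :: "nat \<Rightarrow> ('a, 'm) ring_scheme \<Rightarrow> ('b, 'n) ring_scheme \<Rightarrow> ('a \<Rightarrow> 'b) \<Rightarrow> bool" where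
  "cohen_ring p A k res \<longleftrightarrow>
     cring A \<and> noetherian_ring A \<and>
     maximalideal (max_ideal p A) A \<and>
     (\<forall>x\<in>carrier A - max_ideal p A. x \<in> Units A) \<and>
     padic_complete p A \<and>
     field k \<and> res \<in> ring_hom A k \<and> res ` carrier A = carrier k \<and>
     {x\<in>carrier A. res x = \<zero>\<^bsub>k\<^esub>} = max_ideal p A"

definition cohen_morphism ::
  "nat \<Rightarrow> ('a, 'm) ring_scheme \<Rightarrow> ('b, 'n) ring_scheme \<Rightarrow> ('a \<Rightarrow> 'b) \<Rightarrow>
   ('c, 'o) ring_scheme \<Rightarrow> ('d, 'q) ring_scheme \<Rightarrow> ('c \<Rightarrow> 'd) \<Rightarrow>
   ('a \<Rightarrow> 'c) \<Rightarrow> ('b \<Rightarrow> 'd) \<Rightarrow> bool" where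
  "cohen_morphism p A k resA B l resB fA fk \<longleftrightarrow>
     fA \<in> ring_hom A B \<and> fk \<in> ring_hom k l \<and>
     {x\<in>carrier A. fA x \<in> max_ideal p B} = max_ideal p A \<and>
     (\<forall>x\<in>carrier A. fk (resA x) = resB (fA x))"

definition cohen_ext ::
  "nat \<Rightarrow> 'a set \<Rightarrow> 'b set \<Rightarrow> ('a \<Rightarrow> 'b) \<Rightarrow> ('a, 'm) ring_scheme \<Rightarrow> ('b, 'n) ring_scheme \<Rightarrow> ('a \<Rightarrow> 'b) \<Rightarrow> bool"
  where
  "cohen_ext p S K res1 A k res2 \<longleftrightarrow>
     cohen_ring p A k res2 \<and> subring S A \<and> subfield K k \<and>
     cohen_ring p (A\<lparr>carrier := S\<rparr>) (k\<lparr>carrier := K\<rparr>) res1 \<and>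
     cohen_morphism p (A\<lparr>carrier := S\<rparr>) (k\<lparr>carrier := K\<rparr>) res1 A k res2 id id"

definition pbase :: "nat \<Rightarrow> ('b, 'n) ring_scheme \<Rightarrow> 'b set \<Rightarrow> 'b set" where
  "pbase p k K = generate_field k ({x [^]\<^bsub>k\<^esub> p | x. x \<in> carrier k} \<union> K)"

definition p_indep_over :: "nat \<Rightarrow> ('b, 'n) ring_scheme \<Rightarrow> 'b set \<Rightarrow> 'b set \<Rightarrow> bool" where
  "p_indep_over p k K T \<longleftrightarrow> T \<subseteq> carrier k \<and>
     (\<forall>S\<subseteq>T. finite S \<longrightarrow>
        ring.dimension k (p ^ card S) (pbase p k K) (generate_field k (pbase p k K \<union> S)))"

definition p_basis_over :: "nat \<Rightarrow> ('b, 'n) ring_scheme \<Rightarrow> 'b set \<Rightarrow> 'b set \<Rightarrow> bool" where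
  "p_basis_over p k K T \<longleftrightarrow> p_indep_over p k K T \<and>
     generate_field k (pbase p k K \<union> T) = carrier k"

text \<open>Separability of k over its subfield K (characteristic p, arbitrary extensions):
  every p-independent subset of K (over K^p) stays p-independent in k (over k^p).\<close>

definition separable_ext :: "nat \<Rightarrow> ('b, 'n) ring_scheme \<Rightarrow> 'b set \<Rightarrow> bool" where
  "separable_ext p k K \<longleftrightarrow> subfield K k \<and>
     (\<forall>T\<subseteq>K. p_indep_over p (k\<lparr>carrier := K\<rparr>) {} T \<longrightarrow> p_indep_over p k {} T)"

end

theory Submission
  imports Defs
begin

text \<open>
  Choose a \<open>p\<close>-basis \<open>\<gamma>\<close> of \<open>k\<^sub>1\<close> and lift it to \<open>A\<^sub>1\<close>; by separability, \<open>\<gamma> \<union> \<beta>\<close> is a \<open>p\<close>-basis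
  of \<open>k\<^sub>2\<close>. Starting with the fibre product \<open>G\<^sub>1\<close> of \<open>A\<^sub>2\<close> and \<open>B\<^sub>2\<close> over \<open>l\<^sub>2\<close>, build subrings
  \<open>G\<^sub>n\<close> of \<open>A\<^sub>2 \<times> B\<^sub>2\<close> that are graphs of ring homomorphisms modulo \<open>p^n\<close>: \<open>G\<^sub>n\<^sub>+\<^sub>1\<close> is generated by the
  \<open>p\<close>-th powers of elements of \<open>G\<^sub>n\<close>, the ideal \<open>J = p G\<^sub>n + p^(n+1) (A\<^sub>2 \<times> B\<^sub>2)\<close> and the pairs of
  prescribed representatives. Raising to the \<open>p\<close>-th power improves a congruence modulo \<open>p^n\<close> to one
  modulo \<open>p^(n+1)\<close>. By \<open>p\<close>-independence, the elements of \<open>G\<^sub>n\<^sub>+\<^sub>1\<close> with residue \<open>0\<close> lie in \<open>J\<close>, and so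
  \<open>G\<^sub>n\<^sub>+\<^sub>1\<close> is again a graph: this is seen by adjoining the representatives one at a time, since
  \<open>1, t, \<dots>, t^(p-1)\<close> are linearly independent over every subfield that contains \<open>t^p\<close> but not \<open>t\<close>.
  Every ring homomorphism with the required properties has its graph inside all \<open>G\<^sub>n\<close>, and by
  completeness the intersection of the \<open>G\<^sub>n\<close> is the graph of a homomorphism.
\<close>

section \<open>Binomial expansion and Frobenius\<close>

lemma (in cring) binomial_expansion:
  assumes x: "x \<in> carrier R" and y: "y \<in> carrier R"
  shows "(x \<oplus> y) [^] n = (\<Oplus>i\<in>{..n}. [(n choose i)] \<cdot> (x [^] (n - i) \<otimes> y [^] i))"
proof (induction n)
  case 0
  then show ?case by simp
next
  case (Suc n)
  let ?m = "\<lambda>i. x [^] (Suc n - i) \<otimes> y [^] i"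
  have mc: "?m i \<in> carrier R" for i using x y by simp
  have "x \<otimes> (\<Oplus>i\<in>{..n}. [(n choose i)] \<cdot> (x [^] (n - i) \<otimes> y [^] i)) =
        (\<Oplus>i\<in>{..n}. x \<otimes> ([(n choose i)] \<cdot> (x [^] (n - i) \<otimes> y [^] i)))"
    using x y by (intro finsum_rdistr) auto
  also have "\<dots> = (\<Oplus>i\<in>{..n}. [(n choose i)] \<cdot> ?m i)"
  proof (intro add.finprod_cong' refl)
    fix i assume "i \<in> {..n}"
    then have "x [^] (Suc n - i) = x \<otimes> x [^] (n - i)"
      using x nat_pow_Suc2 Suc_diff_le by simp
    then show "x \<otimes> ([(n choose i)] \<cdot> (x [^] (n - i) \<otimes> y [^] i)) = [(n choose i)] \<cdot> ?m i"
      using x y by (simp add: add_pow_rdistr m_assoc)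
  qed (use x y in auto)
  also have "\<dots> = (\<Oplus>i\<in>{..Suc n}. [(n choose i)] \<cdot> ?m i)"
    using x y mc by (subst finsum_Suc) (auto simp: binomial_eq_0)
  finally have 1: "x \<otimes> (\<Oplus>i\<in>{..n}. [(n choose i)] \<cdot> (x [^] (n - i) \<otimes> y [^] i)) = \<dots>" .
  have "y \<otimes> (\<Oplus>i\<in>{..n}. [(n choose i)] \<cdot> (x [^] (n - i) \<otimes> y [^] i)) =
        (\<Oplus>i\<in>{..n}. y \<otimes> ([(n choose i)] \<cdot> (x [^] (n - i) \<otimes> y [^] i)))"
    using x y by (intro finsum_rdistr) auto
  also have "\<dots> = (\<Oplus>i\<in>{..n}. [(n choose i)] \<cdot> ?m (Suc i))"
    using x y by (intro add.finprod_cong' refl) (auto simp: add_pow_rdistr m_ac)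
  \<comment> \<open>The index shift leaves no term at \<open>i = 0\<close>. The explicit coefficient
    \<open>0\<close> there lets both sums run over \<open>{..Suc n}\<close>, so that Pascal's rule
    applies termwise.\<close>
  also have "\<dots> = (\<Oplus>i\<in>{..Suc n}. [(if i = 0 then 0 else n choose (i - 1))] \<cdot> ?m i)"
    using x y mc by (subst finsum_Suc2) auto
  finally have 2: "y \<otimes> (\<Oplus>i\<in>{..n}. [(n choose i)] \<cdot> (x [^] (n - i) \<otimes> y [^] i)) = \<dots>" .
  have "(x \<oplus> y) [^] Suc n = (x \<oplus> y) \<otimes> (\<Oplus>i\<in>{..n}. [(n choose i)] \<cdot> (x [^] (n - i) \<otimes> y [^] i))"
    using x y by (simp add: Suc.IH m_comm)
  also have "\<dots> = (\<Oplus>i\<in>{..Suc n}. [(n choose i)] \<cdot> ?m i)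
      \<oplus> (\<Oplus>i\<in>{..Suc n}. [(if i = 0 then 0 else n choose (i - 1))] \<cdot> ?m i)"
    unfolding 1[symmetric] 2[symmetric] using x y by (intro l_distr) auto
  also have "\<dots> = (\<Oplus>i\<in>{..Suc n}. [(n choose i)] \<cdot> ?m i \<oplus> [(if i = 0 then 0 else n choose (i - 1))] \<cdot> ?m i)"
    using mc by (intro finsum_addf[symmetric]) auto
  also have "\<dots> = (\<Oplus>i\<in>{..Suc n}. [(Suc n choose i)] \<cdot> ?m i)"
  proof (intro add.finprod_cong' refl)
    fix i assume "i \<in> {..Suc n}"
    have "(n choose i) + (if i = 0 then 0 else n choose (i - 1)) = Suc n choose i"
      by (cases i) auto
    then show "[(n choose i)] \<cdot> ?m i \<oplus> [(if i = 0 then 0 else n choose (i - 1))] \<cdot> ?m i = [(Suc n choose i)] \<cdot> ?m i"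
      by (metis add.nat_pow_mult[OF mc])
  qed (use mc in auto)
  finally show ?case .
qed

lemma (in cring) add_pow_eq_pelem_mult:
  assumes "x \<in> carrier R"
  shows "[n] \<cdot> x = pelem n R \<otimes> x"
  unfolding pelem_def using assms add_pow_ldistr[of \<one> x n] by simp

lemma (in ring) pelem_closed [simp]: "pelem n R \<in> carrier R"
  unfolding pelem_def by simp

text \<open>The middle binomial coefficients are divisible by \<open>p\<close>, and every middle
  term contains a factor \<open>y\<close>. Keeping \<open>y\<close> in the error term matters: when
  \<open>y\<close> is a multiple of \<open>p^n\<close>, the error is a multiple of
  \<open>p^(n+1)\<close>.\<close>

lemma (in cring) prime_power_of_sum:
  assumes p: "Factorial_Ring.prime p" and x: "x \<in> carrier R" and y: "y \<in> carrier R"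
  obtains z where "z \<in> carrier R"
    "(x \<oplus> y) [^] p = x [^] p \<oplus> y [^] p \<oplus> pelem p R \<otimes> (y \<otimes> z)"
proof -
  \<comment> \<open>With \<open>m = p - 2\<close>, the middle terms are \<open>?t (Suc i)\<close>
    for \<open>i \<le> m\<close>.\<close>
  obtain m where m: "p = Suc (Suc m)"
    using prime_ge_2_nat[OF p] by (metis Suc_1 add_2_eq_Suc le_add_diff_inverse)
  let ?t = "\<lambda>i. [(p choose i)] \<cdot> (x [^] (p - i) \<otimes> y [^] i)"
  let ?u = "\<lambda>i. [((p choose Suc i) div p)] \<cdot> (x [^] (p - Suc i) \<otimes> y [^] i)"
  have u: "?t (Suc i) = pelem p R \<otimes> (y \<otimes> ?u i)" if "i \<le> m" for i
  proof -
    have "p dvd (p choose Suc i)" using that m p by (intro dvd_choose_prime) auto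
    then obtain c where c: "p choose Suc i = p * c" by blast
    have "p > 0" using m by simp
    have "?t (Suc i) = [p] \<cdot> ([c] \<cdot> (y \<otimes> (x [^] (p - Suc i) \<otimes> y [^] i)))"
      using x y by (simp add: c add.nat_pow_pow mult.commute m_ac)
    also have "\<dots> = pelem p R \<otimes> (y \<otimes> ?u i)"
      using x y c \<open>p > 0\<close> by (simp add: add_pow_eq_pelem_mult m_lcomm)
    finally show ?thesis .
  qed
  have "(x \<oplus> y) [^] p = (\<Oplus>i\<in>{..p}. ?t i)"
    by (rule binomial_expansion[OF x y])
  also have "\<dots> = y [^] p \<oplus> (\<Oplus>i\<in>{..Suc m}. ?t i)"
    unfolding m using x y by (subst finsum_Suc) auto
  also have "(\<Oplus>i\<in>{..Suc m}. ?t i) = (\<Oplus>i\<in>{..m}. ?t (Suc i)) \<oplus> x [^] p"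
    using x y by (subst finsum_Suc2) auto
  also have "(\<Oplus>i\<in>{..m}. ?t (Suc i)) = (\<Oplus>i\<in>{..m}. pelem p R \<otimes> (y \<otimes> ?u i))"
    using x y u by (intro add.finprod_cong' refl) auto
  also have "\<dots> = pelem p R \<otimes> (\<Oplus>i\<in>{..m}. y \<otimes> ?u i)"
    using x y by (intro finsum_rdistr[symmetric]) auto
  also have "(\<Oplus>i\<in>{..m}. y \<otimes> ?u i) = y \<otimes> (\<Oplus>i\<in>{..m}. ?u i)"
    using x y by (intro finsum_rdistr[symmetric]) auto
  finally have eq: "(x \<oplus> y) [^] p = y [^] p \<oplus> (pelem p R \<otimes> (y \<otimes> (\<Oplus>i\<in>{..m}. ?u i)) \<oplus> x [^] p)" .
  have z: "(\<Oplus>i\<in>{..m}. ?u i) \<in> carrier R" using x y by (intro finsum_closed) auto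
  show thesis
    by (rule that[OF z]) (use x y z in \<open>simp add: eq a_ac\<close>)
qed

lemma (in cring) frobenius_add:
  assumes "Factorial_Ring.prime p" "pelem p R = \<zero>" "x \<in> carrier R" "y \<in> carrier R"
  shows "(x \<oplus> y) [^] p = x [^] p \<oplus> y [^] p"
  using prime_power_of_sum[OF assms(1,3,4)] assms by (metis l_null m_closed nat_pow_closed r_zero add.m_closed)

text \<open>Expanding the \<open>p\<close>-th power of \<open>x + (-x)\<close> avoids a case
  distinction on the parity of \<open>p\<close>.\<close>

lemma (in cring) frobenius_minus:
  assumes p: "Factorial_Ring.prime p" and "pelem p R = \<zero>" "x \<in> carrier R"
  shows "(\<ominus> x) [^] p = \<ominus> (x [^] p)"
proof -
  have "x [^] p \<oplus> (\<ominus> x) [^] p = \<zero>"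
    using frobenius_add[OF assms(1,2), of x "\<ominus> x"] assms prime_gt_0_nat[OF p]
    by (simp add: r_neg nat_pow_zero)
  then show ?thesis using assms by (metis a_inv_closed add.inv_equality add.m_comm nat_pow_closed)
qed

lemma (in domain) nat_pow_eq_zero:
  fixes n :: nat
  assumes "x \<in> carrier R" "x [^] n = \<zero>"
  shows "x = \<zero>"
  using assms(2)
proof (induction n)
  case (Suc n)
  then show ?case using integral[of "x [^] n" x] assms(1) by auto
qed simp

section \<open>Purely inseparable extensions and p-bases\<close>

lemma pelem_hom:
  assumes "h \<in> ring_hom R S" "ring R" "ring S"
  shows "h (pelem n R) = pelem n S"
proof -
  interpret h: ring_hom_ring R S h
    using assms by (simp add: ring_hom_ringI2)
  show ?thesis
    unfolding pelem_def by (induction n) (auto simp: h.R.add.nat_pow_Suc)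
qed

lemma (in ring) pelem_subring:
  "pelem n (R\<lparr>carrier := H\<rparr>) = pelem n R"
  unfolding pelem_def add_pow_def by (simp add: nat_pow_def)

text \<open>Over the subfield, the minimal polynomial is a factor of \<open>(X - x)^p\<close>; splitting it off repeatedly
  from a factor of \<open>(X - x)^p\<close> defined over the subfield shows that its degree divides \<open>p\<close>.\<close>

lemma (in field) degree_Irr_purely_inseparable:
  assumes p: "Factorial_Ring.prime p" and char: "pelem p R = \<zero>"
    and D: "subfield D R" and x: "x \<in> carrier R" "x \<notin> D" "x [^] p \<in> D"
  shows "(algebraic over D) x" and "degree (Irr D x) = p"
proof -
  note Dr = subfieldE(1)[OF D]
  interpret U: domain "poly_ring R" using univ_poly_is_domain[OF carrier_is_subring] .
  interpret UD: domain "D[X]" using univ_poly_is_domain[OF Dr] .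
  interpret c: ring_hom_ring R "poly_ring R" poly_of_const
    using canonical_embedding_ring_hom[OF carrier_is_subring] by simp
  let ?L = "[\<one>, \<ominus> x]"
  have x0: "x \<noteq> \<zero>" using x subringE(2)[OF Dr] by auto
  have mx0: "\<ominus> x \<noteq> \<zero>" using x0 x by (metis a_inv_closed minus_minus minus_zero)
  have L: "?L \<in> carrier (poly_ring R)"
    using x unfolding univ_poly_carrier[symmetric] polynomial_def by auto
  have X: "X \<in> carrier (poly_ring R)" using var_closed(1)[OF carrier_is_subring] .
  have L_eq: "?L = X \<oplus>\<^bsub>poly_ring R\<^esub> poly_of_const (\<ominus> x)"
    using x mx0 by (simp add: univ_poly_add var_def poly_of_const_def)
  have charU: "pelem p (poly_ring R) = \<zero>\<^bsub>poly_ring R\<^esub>"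
    using pelem_hom[OF c.homh ring_axioms U.ring_axioms, of p] char by simp
  \<comment> \<open>\<open>P\<close> is \<open>(X - x)^p\<close>. In characteristic \<open>p\<close>
    it equals \<open>X^p - x^p\<close>, so its coefficients lie in \<open>D\<close>.\<close>
  define P where "P = ?L [^]\<^bsub>poly_ring R\<^esub> p"
  have P_carr: "P \<in> carrier (poly_ring R)" using L by (simp add: P_def)
  have "P = X [^]\<^bsub>poly_ring R\<^esub> p \<oplus>\<^bsub>poly_ring R\<^esub> poly_of_const (\<ominus> x) [^]\<^bsub>poly_ring R\<^esub> p"
    unfolding P_def L_eq using x X by (intro U.frobenius_add[OF p charU]) auto
  also have "poly_of_const (\<ominus> x) [^]\<^bsub>poly_ring R\<^esub> p = poly_of_const (\<ominus> (x [^] p))"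
    using c.hom_nat_pow[of "\<ominus> x" p] frobenius_minus[OF p char x(1)] x by simp
  also have "X [^]\<^bsub>poly_ring R\<^esub> p = X [^]\<^bsub>D[X]\<^esub> p"
    using unitary_monom_eq_var_pow[OF carrier_is_subring] unitary_monom_eq_var_pow[OF Dr] by metis
  finally have P_eq: "P = X [^]\<^bsub>D[X]\<^esub> p \<oplus>\<^bsub>D[X]\<^esub> poly_of_const (\<ominus> (x [^] p))"
    by (simp add: univ_poly_add)
  have "poly_of_const (\<ominus> (x [^] p)) \<in> carrier (D[X])"
    using ring_hom_memE(1)[OF canonical_embedding_is_hom[OF Dr]] subringE(5)[OF Dr x(3)] by simp
  then have PD: "P \<in> carrier (D[X])"
    unfolding P_eq using var_pow_closed[OF Dr] by simp
  have P0: "P \<noteq> []" unfolding P_def using polynomial_pow_not_zero[OF L] by simp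
  have degP: "degree P = p" unfolding P_def using polynomial_pow_degree[OF L] by simp
  obtain m where m: "p = Suc m" using prime_gt_0_nat[OF p] gr0_implies_Suc by blast
  have LP: "?L pdivides P"
    using polynomial_pow_division[OF L, of 1 p] L m unfolding P_def by simp
  have evL: "eval ?L x = \<zero>" using x by (simp add: r_neg)
  have evP: "eval P x = \<zero>" using pdivides_imp_root_sharing[OF L LP x(1) evL] .
  show alg: "(algebraic over D) x" using algebraicI[OF PD P0 evP] by simp
  let ?f = "Irr D x"
  note f = IrrE[OF D x(1) alg]
  have fU: "?f \<in> carrier (poly_ring R)" using carrier_polynomial_shell[OF Dr f(1)] .
  have f0: "?f \<noteq> []" using pirreducibleE(1)[OF Dr f(1,2)] .
  \<comment> \<open>If \<open>x\<close> is not a root of \<open>h\<close>, the irreducible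
    \<open>X - x\<close> does not divide \<open>h\<close>, so all of \<open>(X - x)^p\<close>
    divides the cofactor \<open>r\<close>. By degrees, \<open>h\<close> is then constant.\<close>
  have root: "eval h x = \<zero>" if h: "h \<in> carrier (poly_ring R)" "h pdivides P" "degree h > 0" for h
  proof (rule ccontr)
    assume ne: "eval h x \<noteq> \<zero>"
    obtain r where r: "r \<in> carrier (poly_ring R)" "P = h \<otimes>\<^bsub>poly_ring R\<^esub> r"
      using h(2) unfolding pdivides_def factor_def by auto
    have nd: "\<not> ?L pdivides h"
      using pdivides_imp_root_sharing[OF L _ x(1) evL] ne by blast
    have irr: "pirreducible (carrier R) ?L"
      using degree_one_imp_pirreducible[OF carrier_is_subfield L] by simp
    have "?L [^]\<^bsub>poly_ring R\<^esub> p pdivides (h \<otimes>\<^bsub>poly_ring R\<^esub> r)"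
      using r(2) U.divides_refl[OF P_carr] unfolding P_def pdivides_def by simp
    then have "P pdivides r"
      using pirreducible_pow_pdivides_iff[OF carrier_is_subfield L h(1) r(1) irr nd] P_def by simp
    moreover have hr0: "r \<noteq> []" "h \<noteq> []"
      using r P0 h(1) U.r_null[OF h(1)] U.l_null[OF r(1)] unfolding univ_poly_zero by auto
    ultimately have "p \<le> degree r"
      using pdivides_imp_degree_le[OF carrier_is_subring P_carr r(1)] degP by simp
    moreover have "degree P = degree h + degree r"
      using poly_mult_degree_eq[OF carrier_is_subring, of h r] h(1) r hr0
      unfolding univ_poly_carrier univ_poly_mult by simp
    ultimately show False using degP h(3) by simp
  qed
  \<comment> \<open>A nonconstant \<open>h\<close> over \<open>D\<close> has the root
    \<open>x\<close>, hence the factor \<open>?f\<close>. The quotient is again a divisor of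
    \<open>P\<close> over \<open>D\<close>, of smaller degree, so induction applies.\<close>
  have dvd: "degree ?f dvd degree h"
    if "h \<in> carrier (D[X])" "h pdivides P" "h \<noteq> []" for h
    using that
  proof (induction "degree h" arbitrary: h rule: less_induct)
    case less
    have hU: "h \<in> carrier (poly_ring R)" using carrier_polynomial_shell[OF Dr less.prems(1)] .
    show ?case
    proof (cases "degree h = 0")
      case False
      then have "eval h x = \<zero>" using root[OF hU less.prems(2)] by simp
      then have "?f divides\<^bsub>D[X]\<^esub> h"
        using Irr_minimal[OF D x(1) alg less.prems(1)] pdivides_iff_shell[OF D f(1) less.prems(1)] by simp
      then obtain g where g: "g \<in> carrier (D[X])" "h = ?f \<otimes>\<^bsub>D[X]\<^esub> g"
        unfolding factor_def by auto
      have gU: "g \<in> carrier (poly_ring R)" using carrier_polynomial_shell[OF Dr g(1)] .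
      have g0: "g \<noteq> []" using g(2) less.prems(3) UD.r_null[OF f(1)] unfolding univ_poly_zero by auto
      have hU': "h = ?f \<otimes>\<^bsub>poly_ring R\<^esub> g" using g(2) by (simp add: univ_poly_mult)
      have "g pdivides h"
        unfolding hU' pdivides_def using U.m_comm[OF fU gU] fU gU by (intro dividesI[of "?f"]) auto
      then have gP: "g pdivides P"
        using less.prems(2) gU unfolding pdivides_def by (meson U.divides_trans)
      have deg: "degree h = degree ?f + degree g"
        using poly_mult_degree_eq[OF Dr, of "?f" g] f(1) g f0 g0
        unfolding univ_poly_carrier univ_poly_mult by simp
      have "degree ?f > 0"
      proof (rule ccontr)
        assume "\<not> degree ?f > 0"
        then have "length ?f = 1" using f0 by (cases ?f) auto
        then obtain a where a: "?f = [a]" by (metis One_nat_def length_0_conv length_Suc_conv)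
        then show False using f(3,4) by simp
      qed
      then have "degree ?f dvd degree g" using less.hyps[OF _ g(1) gP g0] deg by linarith
      then show ?thesis using deg by (metis dvd_add dvd_refl)
    qed simp
  qed
  have "degree ?f dvd p"
    using dvd[OF PD _ P0] U.divides_refl[OF P_carr] degP unfolding pdivides_def by simp
  \<comment> \<open>A monic linear polynomial over \<open>D\<close> with root \<open>x\<close> would
    put \<open>x\<close> into \<open>D\<close>.\<close>
  moreover have "degree ?f \<noteq> 1"
  proof
    assume "degree ?f = 1"
    then have "length ?f = Suc (Suc 0)" by simp
    then obtain a b where ab: "?f = [a, b]"
      by (metis (no_types, opaque_lifting) Suc_length_conv length_0_conv)
    then have "a = \<one>" "b \<in> D" "b \<in> carrier R" using f(1,3) subfieldE(3)[OF D]
      unfolding univ_poly_carrier[symmetric] polynomial_def by auto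
    then have "x \<oplus> b = \<zero>" using f(4) x(1) unfolding ab by simp
    then have "x = \<ominus> b" using \<open>b \<in> carrier R\<close> x(1) by (simp add: add.inv_equality)
    then show False using x(2) subringE(5)[OF Dr \<open>b \<in> D\<close>] by simp
  qed
  ultimately show "degree ?f = p" using p by (metis prime_nat_iff)
qed

text \<open>\<open>exp_base\<close> lists the powers of \<open>x\<close> from the highest down,
  hence \<open>rev\<close>. This translates list-based linear combinations into sums.\<close>

lemma (in ring) combine_exp_base:
  assumes "x \<in> carrier R" "\<And>i. d i \<in> carrier R"
  shows "combine (map d (rev [0..<n])) (exp_base x n) = (\<Oplus>i\<in>{..<n}. d i \<otimes> x [^] i)"
proof (induction n)
  case (Suc n)
  then show ?case using assms by (simp add: exp_base_def lessThan_Suc)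
qed (simp add: exp_base_def)

text \<open>The minimal polynomial of \<open>x\<close> over \<open>D\<close> has degree
  \<open>p\<close>, so there is no nontrivial relation of lower degree. This is the fact that
  controls residues when a representative is adjoined.\<close>

lemma (in field) powers_independent_purely_inseparable:
  assumes "Factorial_Ring.prime p" "pelem p R = \<zero>"
    and D: "subfield D R" and x: "x \<in> carrier R" "x \<notin> D" "x [^] p \<in> D"
    and d: "\<And>i. d i \<in> D" and sum: "(\<Oplus>i\<in>{..<p}. d i \<otimes> x [^] i) = \<zero>" and i: "i < p"
  shows "d i = \<zero>"
proof -
  note I = degree_Irr_purely_inseparable[OF assms(1,2) D x]
  have ind: "independent D (exp_base x p)"
    using exp_base_independent[OF D x(1) I(1)] I(2) by simp
  have dc: "d i \<in> carrier R" for i using d subfieldE(3)[OF D] by blast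
  have "combine (map d (rev [0..<p])) (exp_base x p) = \<zero>"
    using sum combine_exp_base[of x d p, OF x(1) dc] by simp
  then have "set (take (length (exp_base x p)) (map d (rev [0..<p]))) \<subseteq> {\<zero>}"
    by (intro independent_imp_trivial_combine[OF D ind]) (use d in auto)
  then show ?thesis using i by (auto simp: exp_base_def image_subset_iff)
qed

lemma (in field) dimension_purely_inseparable:
  assumes "Factorial_Ring.prime p" "pelem p R = \<zero>"
    and D: "subfield D R" and x: "x \<in> carrier R" "x \<notin> D" "x [^] p \<in> D"
  shows "dimension p D (generate_field R (D \<union> {x}))"
proof -
  note I = degree_Irr_purely_inseparable[OF assms(1,2) D x]
  have "simple_extension D x = generate_field R (D \<union> {x})"
  proof (rule generate_fieldI)
    show "subfield (simple_extension D x) R"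
      using simple_extension_is_subfield[OF D x(1)] I(1) by simp
    show "D \<union> {x} \<subseteq> simple_extension D x"
      using simple_extension_incl[OF subfieldE(3)[OF D] x(1)]
        simple_extension_mem[OF subfieldE(1)[OF D] x(1)] by simp
  qed (use x subfieldE(3)[OF D] in \<open>auto dest!: subfieldE(1) intro: simple_extension_subring_incl[THEN subsetD]\<close>)
  then show ?thesis
    using dimension_simple_extension[OF D x(1) I(1)] I(2) by simp
qed

section \<open>\<open>p\<close>-independence, existence of \<open>p\<close>-bases and generation by
  them\<close>

lemma (in field) pbase_subfield:
  assumes "K \<subseteq> carrier R"
  shows "subfield (pbase p R K) R"
  unfolding pbase_def using assms by (intro generate_field_is_subfield) auto

lemma (in field) power_in_pbase:
  assumes "x \<in> carrier R"
  shows "x [^] p \<in> pbase p R K"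
  unfolding pbase_def using assms by (intro generate_field.incl) auto

lemma (in field) generate_field_subfield_eq:
  assumes "subfield E R"
  shows "generate_field R E = E"
  using assms by (intro generate_fieldI[symmetric]) (auto dest: subfieldE(3))

lemma (in field) generate_field_union_generate:
  assumes "H \<subseteq> carrier R" "S \<subseteq> carrier R"
  shows "generate_field R (generate_field R H \<union> S) = generate_field R (H \<union> S)"
proof (rule generate_fieldI)
  have HS: "H \<union> S \<subseteq> carrier R" and GS: "generate_field R H \<union> S \<subseteq> carrier R"
    using assms generate_field_incl by auto
  show "H \<union> S \<subseteq> carrier R" by (rule HS)
  show "subfield (generate_field R (generate_field R H \<union> S)) R"
    by (rule generate_field_is_subfield[OF GS])
  show "H \<union> S \<subseteq> generate_field R (generate_field R H \<union> S)"
    by (auto intro: generate_field.incl)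
  fix L assume "subfield L R" "H \<union> S \<subseteq> L"
  then show "generate_field R (generate_field R H \<union> S) \<subseteq> L"
    using generate_field_min_subfield1[of H L] assms GS
    by (intro generate_field_min_subfield1) auto
qed

text \<open>If \<open>t\<close> already lay in the field generated by \<open>S\<close>, adjoining it
  would change nothing, and one field would have both degrees \<open>p ^ card S\<close> and
  \<open>p ^ Suc (card S)\<close>. This turns the definition by degrees into a condition on single
  elements.\<close>

lemma (in field) p_indep_over_not_mem:
  assumes p: "Factorial_Ring.prime p" and K: "K \<subseteq> carrier R"
    and ind: "p_indep_over p R K T" and S: "finite S" "S \<subseteq> T" and t: "t \<in> T - S"
  shows "t \<notin> generate_field R (pbase p R K \<union> S)"
proof
  let ?C = "pbase p R K"
  assume mem: "t \<in> generate_field R (?C \<union> S)"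
  have T: "T \<subseteq> carrier R" using ind by (simp add: p_indep_over_def)
  have C: "subfield ?C R" using pbase_subfield[OF K] .
  have CS: "?C \<union> S \<subseteq> carrier R" "?C \<union> insert t S \<subseteq> carrier R"
    using subfieldE(3)[OF C] T S t by auto
  have "?C \<union> insert t S \<subseteq> generate_field R (?C \<union> S)"
    using mem by (auto intro: generate_field.incl)
  then have "generate_field R (?C \<union> insert t S) \<subseteq> generate_field R (?C \<union> S)"
    by (rule generate_field_min_subfield1[OF CS(2) generate_field_is_subfield[OF CS(1)]])
  moreover have "generate_field R (?C \<union> S) \<subseteq> generate_field R (?C \<union> insert t S)"
    by (rule mono_generate_field[OF _ CS(2)]) auto
  ultimately have eq: "generate_field R (?C \<union> insert t S) = generate_field R (?C \<union> S)" by simp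
  have "dimension (p ^ card S) ?C (generate_field R (?C \<union> S))"
    using ind S unfolding p_indep_over_def by blast
  moreover have "dimension (p ^ card (insert t S)) ?C (generate_field R (?C \<union> insert t S))"
    using ind S t unfolding p_indep_over_def by (meson DiffD1 finite_insert insert_subset)
  ultimately have "p ^ card S = p ^ card (insert t S)"
    using dimension_is_inj[OF C] eq by metis
  then show False using prime_gt_1_nat[OF p] S t by simp
qed

text \<open>Degrees multiply in towers. Over the field generated by the other elements,
  \<open>x\<close> has degree exactly \<open>p\<close>, because its \<open>p\<close>-th power is in
  the base.\<close>

lemma (in field) p_indep_over_insert:
  assumes p: "Factorial_Ring.prime p" and char: "pelem p R = \<zero>" and K: "K \<subseteq> carrier R"
    and ind: "p_indep_over p R K T"
    and x: "x \<in> carrier R" "x \<notin> generate_field R (pbase p R K \<union> T)"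
  shows "p_indep_over p R K (insert x T)"
  unfolding p_indep_over_def
proof (intro conjI allI impI)
  let ?C = "pbase p R K"
  have T: "T \<subseteq> carrier R" using ind by (simp add: p_indep_over_def)
  then show "insert x T \<subseteq> carrier R" using x by simp
  have C: "subfield ?C R" using pbase_subfield[OF K] .
  fix S assume S: "S \<subseteq> insert x T" "finite S"
  show "dimension (p ^ card S) ?C (generate_field R (?C \<union> S))"
  proof (cases "x \<in> S")
    case False
    then show ?thesis using ind S unfolding p_indep_over_def by blast
  next
    case True
    define S0 where "S0 = S - {x}"
    have S0: "S0 \<subseteq> T" "finite S0" "S = insert x S0" "x \<notin> S0" using S True by (auto simp: S0_def)
    let ?E = "generate_field R (?C \<union> S0)"
    have CS: "?C \<union> S0 \<subseteq> carrier R" "?C \<union> T \<subseteq> carrier R"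
      using subfieldE(3)[OF C] T S0 by auto
    have E: "subfield ?E R" using generate_field_is_subfield[OF CS(1)] .
    have dimE: "dimension (p ^ card S0) ?C ?E" using ind S0 unfolding p_indep_over_def by blast
    have "x \<notin> ?E" using x(2) mono_generate_field[of "?C \<union> S0" "?C \<union> T"] CS S0 by blast
    moreover have "x [^] p \<in> ?E"
      using power_in_pbase[OF x(1)] by (auto intro: generate_field.incl)
    ultimately have "dimension p ?E (generate_field R (?E \<union> {x}))"
      by (intro dimension_purely_inseparable[OF p char E x(1)])
    then have "dimension (p ^ card S0 * p) ?C (generate_field R (?E \<union> {x}))"
      by (rule telescopic_base[OF C E dimE])
    moreover have "generate_field R (?E \<union> {x}) = generate_field R (?C \<union> S)"
      using generate_field_union_generate[OF CS(1), of "{x}"] x S0 by simp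
    ultimately show ?thesis using S0 by (simp add: mult.commute)
  qed
qed

text \<open>\<open>p\<close>-independence only concerns finite subsets, so it passes to unions of
  chains and Zorn's lemma applies. A maximal set generates everything, since any element outside
  could be added by \<open>p_indep_over_insert\<close>.\<close>

lemma (in field) exists_p_basis_over:
  assumes p: "Factorial_Ring.prime p" and char: "pelem p R = \<zero>" and K: "K \<subseteq> carrier R"
  shows "\<exists>T. p_basis_over p R K T"
proof -
  let ?C = "pbase p R K"
  have C: "subfield ?C R" using pbase_subfield[OF K] .
  let ?A = "{T. p_indep_over p R K T}"
  have "\<exists>M\<in>?A. \<forall>N\<in>?A. M \<subseteq> N \<longrightarrow> N = M"
  proof (rule subset_Zorn')
    fix Ch assume Ch: "subset.chain ?A Ch"
    show "\<Union>Ch \<in> ?A"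
    proof (cases "Ch = {}")
      \<comment> \<open>For the empty chain the union is empty, and the claim is that the base has
        dimension 1 over itself.\<close>
      case True
      then show ?thesis
        using generate_field_subfield_eq[OF C] dimension_one[OF C] by (auto simp: p_indep_over_def)
    next
      case False
      have "p_indep_over p R K (\<Union>Ch)"
        unfolding p_indep_over_def
      proof (intro conjI allI impI)
        show "\<Union>Ch \<subseteq> carrier R" using Ch by (auto simp: subset.chain_def p_indep_over_def)
        fix S assume S: "S \<subseteq> \<Union>Ch" "finite S"
        obtain T where "T \<in> Ch" "S \<subseteq> T"
          using finite_subset_Union_chain[OF S(2,1) False Ch] by blast
        then show "dimension (p ^ card S) ?C (generate_field R (?C \<union> S))"
          using Ch S(2) unfolding subset.chain_def p_indep_over_def by blast
      qed
      then show ?thesis by simp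
    qed
  qed
  then obtain M where M: "p_indep_over p R K M"
    and max: "\<And>N. p_indep_over p R K N \<Longrightarrow> M \<subseteq> N \<Longrightarrow> N = M" by auto
  have MC: "M \<subseteq> carrier R" using M by (simp add: p_indep_over_def)
  have "generate_field R (?C \<union> M) = carrier R"
  proof (intro subset_antisym subsetI)
    fix x assume "x \<in> generate_field R (?C \<union> M)"
    then show "x \<in> carrier R"
      using generate_field_incl[of "?C \<union> M"] subfieldE(3)[OF C] MC by auto
  next
    fix x assume x: "x \<in> carrier R"
    show "x \<in> generate_field R (?C \<union> M)"
    proof (rule ccontr)
      assume nx: "x \<notin> generate_field R (?C \<union> M)"
      then have "insert x M = M"
        using max[OF p_indep_over_insert[OF p char K M x nx]] by blast
      then show False using nx by (auto intro: generate_field.incl)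
    qed
  qed
  then show ?thesis using M by (auto simp: p_basis_over_def)
qed

text \<open>The inverse of \<open>x\<close> is the product of \<open>x^(p-1)\<close> and the
  \<open>p\<close>-th power of the inverse, and both factors lie in \<open>Y\<close>.\<close>

lemma (in field) subring_containing_powers_is_subfield:
  fixes p :: nat
  assumes p: "Factorial_Ring.prime p" and Y: "subring Y R"
    and pow: "\<And>x. x \<in> carrier R \<Longrightarrow> x [^] p \<in> Y"
  shows "subfield Y R"
proof (rule subfieldI'[OF Y])
  fix x assume x: "x \<in> Y - {\<zero>}"
  then have xc: "x \<in> carrier R" "x \<in> Units R" using subringE(1)[OF Y] field_Units by auto
  obtain m where m: "p = Suc m" using prime_gt_0_nat[OF p] gr0_implies_Suc by blast
  have "x [^] m \<in> Y" using x subringE(3,6)[OF Y] by (induction m) auto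
  then have "x [^] m \<otimes> inv x [^] p \<in> Y" using pow xc by (intro subringE(6)[OF Y]) auto
  moreover have "x [^] m \<otimes> inv x [^] p = inv x"
  proof -
    have "x [^] m \<otimes> inv x [^] m = \<one>"
      using xc by (metis Units_inv_closed Units_r_inv nat_pow_distrib nat_pow_one)
    then show ?thesis using xc unfolding m by (simp add: m_assoc[symmetric])
  qed
  ultimately show "inv x \<in> Y" by simp
qed

text \<open>Such a subring is automatically a subfield, hence contains the field generated by
  \<open>pbase p R K\<close> and \<open>T\<close>. It reduces surjectivity onto a residue field to
  checking generators.\<close>

lemma (in field) subring_containing_p_basis:
  assumes p: "Factorial_Ring.prime p" and basis: "p_basis_over p R K T"
    and Y: "subring Y R" and pow: "\<And>x. x \<in> carrier R \<Longrightarrow> x [^] p \<in> Y"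
    and K: "K \<subseteq> Y" and T: "T \<subseteq> Y"
  shows "Y = carrier R"
proof -
  have sf: "subfield Y R" using subring_containing_powers_is_subfield[OF p Y pow] .
  have Yc: "Y \<subseteq> carrier R" using subringE(1)[OF Y] .
  have "pbase p R K \<subseteq> Y"
    unfolding pbase_def using pow K Yc by (intro generate_field_min_subfield1[OF _ sf]) auto
  then have "generate_field R (pbase p R K \<union> T) \<subseteq> Y"
    using T Yc by (intro generate_field_min_subfield1[OF _ sf]) auto
  then show ?thesis using basis Yc by (auto simp: p_basis_over_def)
qed

section \<open>Adjoining lifts of p-independent elements\<close>

lemma (in abelian_monoid) finsum_mem:
  fixes n :: nat
  assumes "H \<subseteq> carrier G" "\<And>x y. x \<in> H \<Longrightarrow> y \<in> H \<Longrightarrow> x \<oplus> y \<in> H" "\<And>i. f i \<in> H"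
  shows "(\<Oplus>i\<in>{..n}. f i) \<in> H"
proof (induction n)
  case 0
  then show ?case using assms by (subst finsum_0) auto
next
  case (Suc n)
  then show ?case using assms by (subst finsum_Suc) auto
qed

text \<open>Polynomial expressions in \<open>t\<close> of degree at most \<open>m\<close> are closed
  under multiplication by \<open>t\<close>, because the overflowing power \<open>t [^] Suc m\<close>
  lies in \<open>W\<close> and can be absorbed into the constant coefficient.\<close>

lemma (in cring) subring_adjoin_root:
  assumes W: "subring W R" and t: "t \<in> carrier R" and tm: "t [^] Suc m \<in> W"
  shows "subring {\<Oplus>i\<in>{..m}. c i \<otimes> t [^] i | c. \<forall>i. c i \<in> W} R" (is "subring ?Z R")
    and "W \<subseteq> {\<Oplus>i\<in>{..m}. c i \<otimes> t [^] i | c. \<forall>i. c i \<in> W}"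
    and "t \<in> {\<Oplus>i\<in>{..m}. c i \<otimes> t [^] i | c. \<forall>i. c i \<in> W}"
proof -
  note Ws = subringE[OF W]
  have Wc: "x \<in> carrier R" if "x \<in> W" for x using that Ws(1) by blast
  have tc: "t [^] i \<in> carrier R" for i :: nat using t by simp
  have Zc: "?Z \<subseteq> carrier R" using Wc tc by (auto intro!: finsum_closed)
  have ZI: "(\<Oplus>i\<in>{..m}. c i \<otimes> t [^] i) \<in> ?Z" if "\<And>i. c i \<in> W" for c using that by blast
  show WZ: "W \<subseteq> ?Z"
  proof
    fix x assume x: "x \<in> W"
    let ?c = "\<lambda>i::nat. if i = 0 then x else \<zero>"
    have "(\<Oplus>i\<in>{..m}. ?c i \<otimes> t [^] i) = (\<Oplus>i\<in>{..m}. if 0 = i then x else \<zero>)"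
      using Wc[OF x] tc by (intro add.finprod_cong') auto
    also have "\<dots> = x" using Wc[OF x] by (intro add.finprod_singleton) auto
    finally show "x \<in> ?Z" using ZI[of ?c] x Ws(2) by auto
  qed
  have add: "z \<oplus> w \<in> ?Z" if "z \<in> ?Z" "w \<in> ?Z" for z w
  proof -
    obtain c d where c: "\<And>i. c i \<in> W" "z = (\<Oplus>i\<in>{..m}. c i \<otimes> t [^] i)"
      and d: "\<And>i. d i \<in> W" "w = (\<Oplus>i\<in>{..m}. d i \<otimes> t [^] i)" using \<open>z \<in> ?Z\<close> \<open>w \<in> ?Z\<close> by blast
    have "z \<oplus> w = (\<Oplus>i\<in>{..m}. c i \<otimes> t [^] i \<oplus> d i \<otimes> t [^] i)"
      unfolding c d using Wc c(1) d(1) tc by (intro finsum_addf[symmetric]) auto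
    also have "\<dots> = (\<Oplus>i\<in>{..m}. (c i \<oplus> d i) \<otimes> t [^] i)"
      using Wc c(1) d(1) tc by (intro add.finprod_cong') (auto simp: l_distr)
    finally show ?thesis using ZI[of "\<lambda>i. c i \<oplus> d i"] c(1) d(1) Ws(7) by auto
  qed
  have smult: "x \<otimes> z \<in> ?Z" if "x \<in> W" "z \<in> ?Z" for x z
  proof -
    obtain c where c: "\<And>i. c i \<in> W" "z = (\<Oplus>i\<in>{..m}. c i \<otimes> t [^] i)" using \<open>z \<in> ?Z\<close> by blast
    have "x \<otimes> z = (\<Oplus>i\<in>{..m}. x \<otimes> (c i \<otimes> t [^] i))"
      unfolding c using Wc c(1) tc \<open>x \<in> W\<close> by (intro finsum_rdistr) auto
    also have "\<dots> = (\<Oplus>i\<in>{..m}. (x \<otimes> c i) \<otimes> t [^] i)"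
      using Wc c(1) \<open>x \<in> W\<close> tc by (intro add.finprod_cong') (auto simp: m_assoc)
    finally show ?thesis using ZI[of "\<lambda>i. x \<otimes> c i"] c(1) \<open>x \<in> W\<close> Ws(6) by auto
  qed
  have tmult: "z \<otimes> t \<in> ?Z" if "z \<in> ?Z" for z
  proof -
    obtain c where c: "\<And>i. c i \<in> W" "z = (\<Oplus>i\<in>{..m}. c i \<otimes> t [^] i)" using \<open>z \<in> ?Z\<close> by blast
    have cc: "c i \<in> carrier R" for i using Wc c(1) by blast
    \<comment> \<open>Multiplication by \<open>t\<close> shifts all coefficients up by one; the top
      one wraps around to index \<open>0\<close>, multiplied by \<open>t [^] Suc m\<close>.\<close>
    let ?d = "\<lambda>i. case i of 0 \<Rightarrow> c m \<otimes> t [^] Suc m | Suc j \<Rightarrow> c j"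
    have dX: "?d i \<in> W" for i using c(1) tm Ws(6) by (cases i) auto
    have "z \<otimes> t = (\<Oplus>i\<in>{..m}. (c i \<otimes> t [^] i) \<otimes> t)"
      unfolding c using cc t by (intro finsum_ldistr) auto
    also have "\<dots> = (\<Oplus>i\<in>{..m}. c i \<otimes> t [^] Suc i)"
      using cc t by (intro add.finprod_cong') (auto simp: m_assoc)
    also have "\<dots> = (\<Oplus>i\<in>{..m}. ?d i \<otimes> t [^] i)"
    proof (cases m)
      case 0
      then show ?thesis using cc t by simp
    next
      case (Suc q)
      have "(\<Oplus>i\<in>{..m}. c i \<otimes> t [^] Suc i) = c m \<otimes> t [^] Suc m \<oplus> (\<Oplus>i\<in>{..q}. c i \<otimes> t [^] Suc i)"
        unfolding Suc using cc t by (intro finsum_Suc) auto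
      also have "\<dots> = (\<Oplus>i\<in>{..q}. ?d (Suc i) \<otimes> t [^] Suc i) \<oplus> ?d 0 \<otimes> t [^] (0::nat)"
        using cc t by (simp add: a_comm)
      also have "\<dots> = (\<Oplus>i\<in>{..m}. ?d i \<otimes> t [^] i)"
        unfolding Suc using cc t by (intro finsum_Suc2[symmetric]) (auto split: nat.split)
      finally show ?thesis .
    qed
    finally show ?thesis using ZI[of ?d] dX by simp
  qed
  have tpow: "z \<otimes> t [^] i \<in> ?Z" if "z \<in> ?Z" for z and i :: nat
  proof (induction i)
    case 0
    have "z \<in> carrier R" using that Zc by blast
    then have "z \<otimes> t [^] (0::nat) = z" by simp
    then show ?case using that by (simp only:)
  next
    case (Suc i)
    have "z \<in> carrier R" using that Zc by blast
    then show ?case using tmult[OF Suc] t by (simp add: m_assoc)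
  qed
  have one: "\<one> \<in> ?Z" using WZ Ws(3) by blast
  show "t \<in> ?Z" using tmult[OF one] t by simp
  show "subring ?Z R"
  proof (rule subringI)
    fix z assume z: "z \<in> ?Z"
    then have "z \<in> carrier R" using Zc by blast
    then show "\<ominus> z \<in> ?Z" using smult[OF Ws(5)[OF Ws(3)] z] by (simp add: l_minus)
  next
    fix z w assume z: "z \<in> ?Z" and w: "w \<in> ?Z"
    obtain c where c: "\<And>i. c i \<in> W" "w = (\<Oplus>i\<in>{..m}. c i \<otimes> t [^] i)" using w by blast
    have cc: "c i \<in> carrier R" for i using Wc c(1) by blast
    have zc: "z \<in> carrier R" using z Zc by blast
    have "z \<otimes> w = (\<Oplus>i\<in>{..m}. z \<otimes> (c i \<otimes> t [^] i))"
      unfolding c using zc cc tc by (intro finsum_rdistr) auto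
    also have "\<dots> \<in> ?Z"
    proof (rule finsum_mem[OF Zc add])
      fix i
      show "z \<otimes> (c i \<otimes> t [^] i) \<in> ?Z"
        using tpow[OF smult[OF c(1) z], of i i] zc cc tc by (simp add: m_ac)
    qed
    finally show "z \<otimes> w \<in> ?Z" .
  qed (use one add Zc in auto)
qed

text \<open>The abstract setting of one refinement step, later used with a ring \<open>G\<close> of
  approximations and its ideal \<open>J\<close>. Since \<open>J\<close> contains \<open>p\<close>,
  taking \<open>p\<close>-th powers is additive modulo \<open>J\<close>; by
  \<open>ker_power\<close>, the result modulo \<open>J\<close> depends only on the residue.\<close>

locale frobenius_ideal = R?: cring R + k: field k + h: ring_hom_ring R k \<pi>
  for R (structure) and k (structure) and \<pi> and p :: nat and J +
  assumes prime: "Factorial_Ring.prime p"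
    and char: "pelem p k = \<zero>\<^bsub>k\<^esub>"
    and J: "ideal J R"
    and p_in_J: "pelem p R \<in> J"
    and ker_power: "x \<in> carrier R \<Longrightarrow> \<pi> x = \<zero>\<^bsub>k\<^esub> \<Longrightarrow> x [^] p \<in> J"
begin

lemma J_mem:
  "x \<in> J \<Longrightarrow> x \<in> carrier R" "\<zero> \<in> J" "x \<in> J \<Longrightarrow> y \<in> J \<Longrightarrow> x \<oplus> y \<in> J" "x \<in> J \<Longrightarrow> \<ominus> x \<in> J"
  "x \<in> J \<Longrightarrow> y \<in> carrier R \<Longrightarrow> y \<otimes> x \<in> J" "x \<in> J \<Longrightarrow> y \<in> carrier R \<Longrightarrow> x \<otimes> y \<in> J"
  using J additive_subgroup.a_subset[OF ideal.axioms(1)[OF J]]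
    additive_subgroup.zero_closed[OF ideal.axioms(1)[OF J]]
    additive_subgroup.a_closed[OF ideal.axioms(1)[OF J]]
    additive_subgroup.a_inv_closed[OF ideal.axioms(1)[OF J]]
    ideal.I_l_closed[OF J] ideal.I_r_closed[OF J] by auto

text \<open>The preimage in \<open>R\<close> of the image of the Frobenius endomorphism of
  \<open>R/J\<close>.\<close>

definition powers_mod :: "'a set" where
  "powers_mod = {x [^] p \<oplus> j | x j. x \<in> carrier R \<and> j \<in> J}"

lemma powers_modI: "x \<in> carrier R \<Longrightarrow> j \<in> J \<Longrightarrow> x [^] p \<oplus> j \<in> powers_mod"
  unfolding powers_mod_def by blast

lemma powers_mod_subring: "subring powers_mod R"
proof (rule subringI)
  show "powers_mod \<subseteq> carrier R" unfolding powers_mod_def using J_mem by auto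
  show "\<one> \<in> powers_mod" using powers_modI[OF one_closed J_mem(2)] by simp
next
  fix a assume "a \<in> powers_mod"
  then obtain x j where x: "x \<in> carrier R" "j \<in> J" "a = x [^] p \<oplus> j" unfolding powers_mod_def by blast
  \<comment> \<open>Expanding \<open>(x + (-x))^p = 0\<close> shows that the powers of
    \<open>x\<close> and of its negative cancel up to a multiple of \<open>p\<close>, which is in
    \<open>J\<close>.\<close>
  obtain z where z: "z \<in> carrier R"
    "(x \<oplus> \<ominus> x) [^] p = x [^] p \<oplus> (\<ominus> x) [^] p \<oplus> pelem p R \<otimes> (\<ominus> x \<otimes> z)"
    using prime_power_of_sum[OF prime x(1) a_inv_closed[OF x(1)]] .
  let ?e = "pelem p R \<otimes> (\<ominus> x \<otimes> z)"
  have e: "?e \<in> J" using J_mem(6)[OF p_in_J] x z by simp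
  have "\<zero> = x [^] p \<oplus> (\<ominus> x) [^] p \<oplus> ?e"
    using z(2) x prime_gt_0_nat[OF prime] by (simp add: r_neg nat_pow_zero)
  then have "(x [^] p \<oplus> j) \<oplus> ((\<ominus> x) [^] p \<oplus> (?e \<oplus> \<ominus> j)) = \<zero>"
    using x z e J_mem by (simp add: a_ac r_neg1 r_neg2)
  then have "\<ominus> a = (\<ominus> x) [^] p \<oplus> (?e \<oplus> \<ominus> j)"
    using x z e J_mem by (simp add: minus_equality a_comm)
  then show "\<ominus> a \<in> powers_mod" using powers_modI[of "\<ominus> x" "?e \<oplus> \<ominus> j"] e x J_mem by auto
next
  fix a b assume ab: "a \<in> powers_mod" "b \<in> powers_mod"
  then obtain x j y i where x: "x \<in> carrier R" "j \<in> J" "a = x [^] p \<oplus> j"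
    and y: "y \<in> carrier R" "i \<in> J" "b = y [^] p \<oplus> i" unfolding powers_mod_def by blast
  note c = J_mem(1)[OF x(2)] J_mem(1)[OF y(2)]
  have "a \<otimes> b = (x \<otimes> y) [^] p \<oplus> (x [^] p \<otimes> i \<oplus> (j \<otimes> y [^] p \<oplus> j \<otimes> i))"
    unfolding x(3) y(3) using x y c by (simp add: nat_pow_distrib l_distr r_distr a_ac)
  moreover have "x [^] p \<otimes> i \<oplus> (j \<otimes> y [^] p \<oplus> j \<otimes> i) \<in> J"
    using x y c by (intro J_mem(3) J_mem(5) J_mem(6)) auto
  ultimately show "a \<otimes> b \<in> powers_mod" using powers_modI[of "x \<otimes> y"] x y by simp
  obtain z where z: "z \<in> carrier R" "(x \<oplus> y) [^] p = x [^] p \<oplus> y [^] p \<oplus> pelem p R \<otimes> (y \<otimes> z)"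
    using prime_power_of_sum[OF prime x(1) y(1)] .
  let ?e = "pelem p R \<otimes> (y \<otimes> z)"
  have e: "?e \<in> J" using J_mem(6)[OF p_in_J] y z by simp
  note ec = J_mem(1)[OF e]
  have "a \<oplus> b = (x \<oplus> y) [^] p \<oplus> (j \<oplus> i \<oplus> \<ominus> ?e)"
  proof -
    have "(x \<oplus> y) [^] p \<oplus> (j \<oplus> i \<oplus> \<ominus> ?e) = (x [^] p \<oplus> y [^] p \<oplus> (j \<oplus> i)) \<oplus> (?e \<oplus> \<ominus> ?e)"
      unfolding z(2) using x y c ec by (simp add: a_ac)
    also have "\<dots> = a \<oplus> b" unfolding x(3) y(3) using x y c ec by (simp add: r_neg a_ac)
    finally show ?thesis by simp
  qed
  moreover have "j \<oplus> i \<oplus> \<ominus> ?e \<in> J" using x y e by (intro J_mem(3) J_mem(4)) auto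
  ultimately show "a \<oplus> b \<in> powers_mod" using powers_modI[of "x \<oplus> y"] x y by simp
qed

text \<open>The residue of \<open>x^p + j\<close> is the \<open>p\<close>-th power of the residue of
  \<open>x\<close>. In a field it vanishes only if the residue of \<open>x\<close> does, and then
  \<open>ker_power\<close> applies. This is the start of the adjunction process.\<close>

lemma powers_mod_ker:
  assumes J_ker: "\<And>j. j \<in> J \<Longrightarrow> \<pi> j = \<zero>\<^bsub>k\<^esub>" and a: "a \<in> powers_mod" "\<pi> a = \<zero>\<^bsub>k\<^esub>"
  shows "a \<in> J"
proof -
  obtain x j where x: "x \<in> carrier R" "j \<in> J" "a = x [^] p \<oplus> j"
    using a(1) unfolding powers_mod_def by blast
  have "\<pi> x [^]\<^bsub>k\<^esub> p = \<zero>\<^bsub>k\<^esub>" using a(2) J_ker[OF x(2)] x J_mem(1) by (simp add: h.hom_nat_pow)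
  then have "\<pi> x = \<zero>\<^bsub>k\<^esub>" using k.nat_pow_eq_zero[of "\<pi> x" p] x by simp
  then show ?thesis using ker_power[OF x(1)] x J_mem(3) by simp
qed

text \<open>The \<open>p\<close>-th power of \<open>t\<close> lies in \<open>W\<close>, so the new
  ring consists of the sums of \<open>c i\<close> times \<open>t^i\<close> with
  \<open>i < p\<close>. If such a sum has residue zero, linear independence of the powers of
  \<open>\<pi> t\<close> over \<open>D\<close> makes every \<open>c i\<close> have residue zero. So
  all \<open>c i\<close>, and with them the sum, lie in \<open>J\<close>.\<close>

lemma adjoin_element:
  assumes W: "subring W R" and pW: "powers_mod \<subseteq> W"
    and ker: "\<And>x. x \<in> W \<Longrightarrow> \<pi> x = \<zero>\<^bsub>k\<^esub> \<Longrightarrow> x \<in> J"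
    and D: "subfield D k" "\<pi> ` W \<subseteq> D"
    and t: "t \<in> carrier R" "\<pi> t \<notin> D"
  shows "\<exists>Z. subring Z R \<and> W \<subseteq> Z \<and> t \<in> Z \<and> \<pi> ` Z \<subseteq> generate_field k (D \<union> {\<pi> t}) \<and>
    (\<forall>z\<in>Z. \<pi> z = \<zero>\<^bsub>k\<^esub> \<longrightarrow> z \<in> J)"
proof -
  obtain m where m: "p = Suc m" using prime_gt_0_nat[OF prime] gr0_implies_Suc by blast
  have tp: "t [^] p \<in> W" using pW powers_modI[OF t(1) J_mem(2)] t by auto
  let ?Z = "{\<Oplus>i\<in>{..m}. c i \<otimes> t [^] i | c. \<forall>i. c i \<in> W}"
  note Z = subring_adjoin_root[OF W t(1) tp[unfolded m]]
  let ?E = "generate_field k (D \<union> {\<pi> t})"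
  have DE: "D \<union> {\<pi> t} \<subseteq> carrier k" using subfieldE(3)[OF D(1)] t by auto
  note Es = subringE[OF subfieldE(1)[OF k.generate_field_is_subfield[OF DE]]]
  have Wc: "x \<in> carrier R" if "x \<in> W" for x using that subringE(1)[OF W] by blast
  have pi_sum: "\<pi> (\<Oplus>i\<in>{..m}. c i \<otimes> t [^] i) = (\<Oplus>\<^bsub>k\<^esub>i\<in>{..m}. \<pi> (c i) \<otimes>\<^bsub>k\<^esub> \<pi> t [^]\<^bsub>k\<^esub> i)"
    if c: "\<forall>i. c i \<in> W" for c
  proof -
    have cc: "c i \<in> carrier R" for i using c Wc by blast
    have "\<pi> (\<Oplus>i\<in>{..m}. c i \<otimes> t [^] i) = (\<Oplus>\<^bsub>k\<^esub>i\<in>{..m}. (\<pi> \<circ> (\<lambda>i. c i \<otimes> t [^] i)) i)"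
      using cc t by (subst h.hom_finsum) (auto simp: comp_def)
    also have "\<dots> = (\<Oplus>\<^bsub>k\<^esub>i\<in>{..m}. \<pi> (c i) \<otimes>\<^bsub>k\<^esub> \<pi> t [^]\<^bsub>k\<^esub> i)"
      using cc t by (intro k.add.finprod_cong') (auto simp: h.hom_nat_pow)
    finally show ?thesis .
  qed
  have pow_mem: "\<pi> t [^]\<^bsub>k\<^esub> i \<in> ?E" for i :: nat
    using Es(3,6) by (induction i) (auto intro: generate_field.incl)
  have "\<pi> ` ?Z \<subseteq> ?E"
  proof (clarify)
    fix c :: "nat \<Rightarrow> 'a" assume c: "\<forall>i. c i \<in> W"
    show "\<pi> (\<Oplus>i\<in>{..m}. c i \<otimes> t [^] i) \<in> ?E"
      unfolding pi_sum[OF c]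
    proof (rule k.finsum_mem[OF Es(1) Es(7)])
      fix i :: nat
      have "\<pi> (c i) \<in> ?E" using c D(2) by (auto intro: generate_field.incl)
      then show "\<pi> (c i) \<otimes>\<^bsub>k\<^esub> \<pi> t [^]\<^bsub>k\<^esub> i \<in> ?E" using Es(6) pow_mem by simp
    qed
  qed
  moreover have "z \<in> J" if z: "z \<in> ?Z" "\<pi> z = \<zero>\<^bsub>k\<^esub>" for z
  proof -
    obtain c where c: "\<forall>i. c i \<in> W" "z = (\<Oplus>i\<in>{..m}. c i \<otimes> t [^] i)" using z(1) by blast
    have tD: "\<pi> t [^]\<^bsub>k\<^esub> p \<in> D" using D(2) tp unfolding h.hom_nat_pow[OF t(1), symmetric] by blast
    have sum: "(\<Oplus>\<^bsub>k\<^esub>i\<in>{..<p}. \<pi> (c i) \<otimes>\<^bsub>k\<^esub> \<pi> t [^]\<^bsub>k\<^esub> i) = \<zero>\<^bsub>k\<^esub>"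
      using pi_sum[OF c(1)] z(2) c(2) by (simp add: m lessThan_Suc_atMost)
    have zero: "\<pi> (c i) = \<zero>\<^bsub>k\<^esub>" if "i < p" for i
      using c(1) D(2) that
      by (intro k.powers_independent_purely_inseparable[OF prime char D(1) h.hom_closed[OF t(1)] t(2) tD _ sum])
        auto
    \<comment> \<open>Coefficients beyond \<open>m\<close> are unconstrained; replacing them by zero
      puts the coefficient into \<open>J\<close> at every index, as \<open>finsum_mem\<close>
      demands.\<close>
    let ?c = "\<lambda>i. if i \<le> m then c i else \<zero>"
    have "z = (\<Oplus>i\<in>{..m}. ?c i \<otimes> t [^] i)"
      unfolding c(2) using c(1) Wc t by (intro add.finprod_cong') auto
    also have "\<dots> \<in> J"
    proof (rule finsum_mem)
      fix i :: nat
      have "?c i \<in> J" using zero[of i] ker c(1) J_mem(2) m by auto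
      then show "?c i \<otimes> t [^] i \<in> J" using t by (intro J_mem(6)) auto
    qed (use J_mem in auto)
    finally show ?thesis .
  qed
  ultimately show ?thesis using Z by (intro exI[of _ ?Z] conjI ballI impI)
qed

text \<open>One application of \<open>adjoin_element\<close> per element of \<open>S\<close>. The
  hypothesis \<open>ind\<close> says that each new residue lies outside the field reached so
  far.\<close>

lemma adjoin_finite:
  assumes W: "subring W R" and pW: "powers_mod \<subseteq> W"
    and ker: "\<And>x. x \<in> W \<Longrightarrow> \<pi> x = \<zero>\<^bsub>k\<^esub> \<Longrightarrow> x \<in> J"
    and D: "D \<subseteq> carrier k" "\<pi> ` W \<subseteq> generate_field k D"
    and S: "finite S" "S \<subseteq> T" and s: "\<And>t. t \<in> T \<Longrightarrow> s t \<in> carrier R \<and> \<pi> (s t) = t"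
    and ind: "\<And>S t. finite S \<Longrightarrow> S \<subseteq> T \<Longrightarrow> t \<in> T - S \<Longrightarrow> t \<notin> generate_field k (D \<union> S)"
  shows "\<exists>Z. subring Z R \<and> W \<subseteq> Z \<and> s ` S \<subseteq> Z \<and> \<pi> ` Z \<subseteq> generate_field k (D \<union> S) \<and>
    (\<forall>z\<in>Z. \<pi> z = \<zero>\<^bsub>k\<^esub> \<longrightarrow> z \<in> J)"
  using S
proof (induction S rule: finite_induct)
  case empty
  then show ?case using W ker D by (intro exI[of _ W]) auto
next
  case (insert t S)
  obtain Y where Y: "subring Y R" "W \<subseteq> Y" "s ` S \<subseteq> Y" "\<pi> ` Y \<subseteq> generate_field k (D \<union> S)"
    "\<And>z. z \<in> Y \<Longrightarrow> \<pi> z = \<zero>\<^bsub>k\<^esub> \<Longrightarrow> z \<in> J" using insert by auto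
  have t: "s t \<in> carrier R" "\<pi> (s t) = t" using s insert.prems by auto
  have "T \<subseteq> carrier k" using s h.hom_closed by fastforce
  then have DS: "D \<union> S \<subseteq> carrier k" "{t} \<subseteq> carrier k" using D insert.prems by auto
  have tn: "\<pi> (s t) \<notin> generate_field k (D \<union> S)" using ind[of S t] insert t by auto
  have pY: "powers_mod \<subseteq> Y" using pW Y(2) by simp
  obtain Z where Z: "subring Z R" "Y \<subseteq> Z" "s t \<in> Z"
    "\<pi> ` Z \<subseteq> generate_field k (generate_field k (D \<union> S) \<union> {\<pi> (s t)})"
    "\<forall>z\<in>Z. \<pi> z = \<zero>\<^bsub>k\<^esub> \<longrightarrow> z \<in> J"
    using adjoin_element[OF Y(1) pY Y(5) k.generate_field_is_subfield[OF DS(1)] Y(4) t(1) tn] by blast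
  have "generate_field k (generate_field k (D \<union> S) \<union> {\<pi> (s t)}) = generate_field k (D \<union> insert t S)"
    using k.generate_field_union_generate[OF DS] t by simp
  then show ?case using Z Y by (intro exI[of _ Z]) auto
qed

end

section \<open>Rings with residue field of characteristic p\<close>

lemma (in ring) subring_of_subring:
  assumes "subring H R" "subring Z (R\<lparr>carrier := H\<rparr>)"
  shows "subring Z R"
proof (rule ring_incl_imp_subring)
  have ZH: "Z \<subseteq> H" using subringE(1)[OF assms(2)] by simp
  then show "Z \<subseteq> carrier R" using subringE(1)[OF assms(1)] by blast
  show "ring (R\<lparr>carrier := Z\<rparr>)"
    using ring.subring_is_ring[OF subring_is_ring[OF assms(1)] assms(2)] by simp
qed

lemma (in ring) subring_in_subring:
  assumes "subring H R" "subring K R" "H \<subseteq> K"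
  shows "subring H (R\<lparr>carrier := K\<rparr>)"
proof (rule ring.ring_incl_imp_subring[OF subring_is_ring[OF assms(2)]])
  show "H \<subseteq> carrier (R\<lparr>carrier := K\<rparr>)" using assms(3) by simp
  show "ring (R\<lparr>carrier := K, carrier := H\<rparr>)" using subring_is_ring[OF assms(1)] by simp
qed

text \<open>Each element is built from finitely many generators. Through this,
  \<open>adjoin_finite\<close> suffices even for an infinite \<open>p\<close>-basis.\<close>

lemma (in ring) generate_ring_finite_support:
  assumes "H \<subseteq> carrier R" "s ` T \<subseteq> carrier R" and x: "x \<in> generate_ring R (H \<union> s ` T)"
  shows "\<exists>S. finite S \<and> S \<subseteq> T \<and> x \<in> generate_ring R (H \<union> s ` S)"
  using x
proof (induction rule: generate_ring.induct)
  case one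
  then show ?case by (intro exI[of _ "{}"]) (auto intro: generate_ring.one)
next
  case (incl h)
  show ?case
  proof (cases "h \<in> H")
    case True
    then show ?thesis by (intro exI[of _ "{}"]) (auto intro: generate_ring.incl)
  next
    case False
    then obtain t where "t \<in> T" "h = s t" using incl by blast
    then show ?thesis by (intro exI[of _ "{t}"]) (auto intro: generate_ring.incl)
  qed
next
  case (a_inv h)
  then show ?case by (meson generate_ring.a_inv)
next
  case (eng_add h1 h2)
  then obtain S1 S2 where S: "finite S1" "S1 \<subseteq> T" "h1 \<in> generate_ring R (H \<union> s ` S1)"
    "finite S2" "S2 \<subseteq> T" "h2 \<in> generate_ring R (H \<union> s ` S2)" by blast
  have "generate_ring R (H \<union> s ` S1) \<subseteq> generate_ring R (H \<union> s ` (S1 \<union> S2))"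
    "generate_ring R (H \<union> s ` S2) \<subseteq> generate_ring R (H \<union> s ` (S1 \<union> S2))"
    using assms S by (intro mono_generate_ring; blast)+
  then show ?case using S by (intro exI[of _ "S1 \<union> S2"]) (auto intro!: generate_ring.eng_add)
next
  case (eng_mult h1 h2)
  then obtain S1 S2 where S: "finite S1" "S1 \<subseteq> T" "h1 \<in> generate_ring R (H \<union> s ` S1)"
    "finite S2" "S2 \<subseteq> T" "h2 \<in> generate_ring R (H \<union> s ` S2)" by blast
  have "generate_ring R (H \<union> s ` S1) \<subseteq> generate_ring R (H \<union> s ` (S1 \<union> S2))"
    "generate_ring R (H \<union> s ` S2) \<subseteq> generate_ring R (H \<union> s ` (S1 \<union> S2))"
    using assms S by (intro mono_generate_ring; blast)+
  then show ?case using S by (intro exI[of _ "S1 \<union> S2"]) (auto intro!: generate_ring.eng_mult)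
qed

section \<open>Powers of the ideal generated by \<open>p\<close>\<close>

lemma (in cring) padic_ideal_iff:
  "x \<in> padic_ideal p R n \<longleftrightarrow> (\<exists>z\<in>carrier R. x = pelem p R [^] n \<otimes> z)"
  unfolding padic_ideal_def cgenideal_def by (auto simp: m_comm)

lemma (in cring) max_ideal_iff:
  "x \<in> max_ideal p R \<longleftrightarrow> (\<exists>z\<in>carrier R. x = pelem p R \<otimes> z)"
  unfolding max_ideal_def cgenideal_def by (auto simp: m_comm)

text \<open>Cancellation of \<open>p\<close> modulo \<open>p^(n+1)\<close>; it needs \<open>p^n \<noteq> 0\<close> because Cohen rings of
  characteristic \<open>p^m\<close> are allowed.\<close>

lemma (in cring) pelem_cancel:
  assumes units: "\<And>x. x \<in> carrier R \<Longrightarrow> x \<notin> max_ideal p R \<Longrightarrow> x \<in> Units R"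
    and proper: "\<one> \<notin> max_ideal p R"
    and n: "pelem p R [^] n \<noteq> \<zero>"
    and x: "x \<in> carrier R" and y: "y \<in> carrier R"
    and eq: "pelem p R \<otimes> x = pelem p R [^] Suc n \<otimes> y"
  shows "x \<in> padic_ideal p R n"
proof (rule ccontr)
  let ?P = "pelem p R"
  assume nx: "x \<notin> padic_ideal p R n"
  \<comment> \<open>Taking the least exponent that fails gives \<open>x = p^j u\<close> with
    \<open>i = j + 1\<close> and \<open>u\<close> outside the maximal ideal, that is, a
    unit.\<close>
  define i where "i = (LEAST i. x \<notin> padic_ideal p R i)"
  have i: "x \<notin> padic_ideal p R i" unfolding i_def using nx by (rule LeastI)
  have "i \<le> n" unfolding i_def using nx by (rule Least_le)
  have "x \<in> padic_ideal p R 0" using x by (auto simp: padic_ideal_iff)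
  then obtain j where j: "i = Suc j" using i by (cases i) auto
  have "x \<in> padic_ideal p R j" using not_less_Least[of j "\<lambda>i. x \<notin> padic_ideal p R i"] j i_def by auto
  then obtain u where u: "u \<in> carrier R" "x = ?P [^] j \<otimes> u" by (auto simp: padic_ideal_iff)
  have "u \<notin> max_ideal p R"
  proof
    assume "u \<in> max_ideal p R"
    then obtain z where "z \<in> carrier R" "u = ?P \<otimes> z" by (auto simp: max_ideal_iff)
    then have "x = ?P [^] i \<otimes> z" using u j by (simp add: m_assoc)
    then show False using i \<open>z \<in> carrier R\<close> by (auto simp: padic_ideal_iff)
  qed
  then have uU: "u \<in> Units R" using units u by blast
  obtain d where d: "n = j + Suc d" using \<open>i \<le> n\<close> j by (metis add_Suc_right add_Suc le_Suc_ex)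
  define w where "w = ?P [^] d \<otimes> (y \<otimes> inv u)"
  have w: "w \<in> carrier R" unfolding w_def using y uU by simp
  \<comment> \<open>Since \<open>i \<le> n\<close>, the right-hand side of \<open>eq\<close> is a
    multiple of \<open>p^(i+1)\<close>, while its left-hand side is \<open>p^i\<close> times a unit.
    Hence \<open>p^i (1 - p w) = 0\<close> for some \<open>w\<close>; as \<open>1 - p w\<close> is a
    unit, \<open>p^i\<close> and then \<open>p^n\<close> vanish.\<close>
  have Pn: "?P [^] Suc n = ?P [^] i \<otimes> (?P \<otimes> ?P [^] d)"
    using nat_pow_mult[of ?P i "Suc d"] nat_pow_Suc2[of ?P d] j d by simp
  have "?P [^] i = (?P \<otimes> x) \<otimes> inv u"
  proof -
    have "(?P \<otimes> x) \<otimes> inv u = ?P [^] i \<otimes> (u \<otimes> inv u)"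
      unfolding u(2) using u(1) uU j by (simp add: m_ac del: Units_r_inv Units_l_inv)
    then show ?thesis using uU by simp
  qed
  also have "\<dots> = ?P [^] i \<otimes> (?P \<otimes> w)"
    unfolding eq Pn w_def using y uU by (simp add: m_assoc)
  finally have e: "?P [^] i = ?P [^] i \<otimes> (?P \<otimes> w)" .
  have "?P [^] i \<otimes> (\<one> \<ominus> ?P \<otimes> w) = ?P [^] i \<ominus> ?P [^] i \<otimes> (?P \<otimes> w)"
    using w by (simp add: r_distr r_minus minus_eq)
  then have z: "?P [^] i \<otimes> (\<one> \<ominus> ?P \<otimes> w) = \<zero>" using e w by (simp add: r_neg minus_eq)
  have "\<one> \<ominus> ?P \<otimes> w \<notin> max_ideal p R"
  proof
    assume "\<one> \<ominus> ?P \<otimes> w \<in> max_ideal p R"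
    then obtain v where v: "v \<in> carrier R" "\<one> \<ominus> ?P \<otimes> w = ?P \<otimes> v" by (auto simp: max_ideal_iff)
    have "\<one> = (\<one> \<ominus> ?P \<otimes> w) \<oplus> ?P \<otimes> w" using w by (simp add: minus_eq a_assoc l_neg)
    then have "\<one> = ?P \<otimes> (v \<oplus> w)" unfolding v(2) using v(1) w by (simp add: r_distr)
    then show False using proper v w by (auto simp: max_ideal_iff)
  qed
  then have vU: "\<one> \<ominus> ?P \<otimes> w \<in> Units R" using units w by simp
  have "?P [^] i = (?P [^] i \<otimes> (\<one> \<ominus> ?P \<otimes> w)) \<otimes> inv (\<one> \<ominus> ?P \<otimes> w)"
    using vU w by (simp add: m_assoc)
  then have "?P [^] i = \<zero>" unfolding z using vU by simp
  then have "?P [^] n = \<zero>" using nat_pow_mult[of ?P i d] j d by simp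
  then show False using n by simp
qed

section \<open>The product of two commutative rings\<close>

lemma fst_RDirProd_hom: "fst \<in> ring_hom (RDirProd A B) A"
  and snd_RDirProd_hom: "snd \<in> ring_hom (RDirProd A B) B"
  by (auto simp: ring_hom_def RDirProd_def DirProd_def monoid.defs)

lemma RDirProd_simps:
  "(a, b) \<otimes>\<^bsub>RDirProd A B\<^esub> (c, d) = (a \<otimes>\<^bsub>A\<^esub> c, b \<otimes>\<^bsub>B\<^esub> d)"
  "(a, b) \<oplus>\<^bsub>RDirProd A B\<^esub> (c, d) = (a \<oplus>\<^bsub>A\<^esub> c, b \<oplus>\<^bsub>B\<^esub> d)"
  "\<one>\<^bsub>RDirProd A B\<^esub> = (\<one>\<^bsub>A\<^esub>, \<one>\<^bsub>B\<^esub>)"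
  by (simp_all add: RDirProd_def DirProd_def monoid.defs)

lemma RDirProd_cring:
  assumes "cring A" "cring B"
  shows "cring (RDirProd A B)"
proof -
  interpret A: cring A by fact
  interpret B: cring B by fact
  interpret Q: ring "RDirProd A B" using RDirProd_ring A.ring_axioms B.ring_axioms .
  show ?thesis
    by (intro cring.intro Q.ring_axioms comm_monoid.intro Q.monoid_axioms)
      (unfold_locales, auto simp: RDirProd_def DirProd_def monoid.defs A.m_comm B.m_comm)
qed

section \<open>Successive approximation of the graph\<close>

text \<open>In the application, \<open>T1\<close> is a \<open>p\<close>-basis of the small residue
  field, \<open>T2\<close> is the given relative one, and \<open>D\<close> consists of the
  \<open>p\<close>-th powers together with the small residue field. Thus \<open>D\<close> is a
  generating set rather than a field. The pair \<open>s t\<close> holds the prescribed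
  representatives over \<open>t\<close>. Condition \<open>char_B\<close> matters when
  \<open>A\<close> has characteristic a power of \<open>p\<close>.\<close>

locale lifting_data =
  A: cring A + B: cring B + k: field k + l: field l +
  rA: ring_hom_ring A k resA + rB: ring_hom_ring B l resB + ph: ring_hom_ring k l Phi
  for A :: "('a, 'm) ring_scheme" and B :: "('c, 'o) ring_scheme"
    and k :: "('b, 'n) ring_scheme" and l :: "('d, 'q) ring_scheme"
    and resA resB Phi +
  fixes p :: nat and T1 T2 D :: "'b set" and s :: "'b \<Rightarrow> 'a \<times> 'c"
  assumes prime: "Factorial_Ring.prime p"
    and kerA: "x \<in> carrier A \<Longrightarrow> resA x = \<zero>\<^bsub>k\<^esub> \<longleftrightarrow> x \<in> max_ideal p A"
    and kerB: "y \<in> carrier B \<Longrightarrow> resB y = \<zero>\<^bsub>l\<^esub> \<longleftrightarrow> y \<in> max_ideal p B"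
    and surjA: "resA ` carrier A = carrier k"
    and surjB: "resB ` carrier B = carrier l"
    and unitsA: "x \<in> carrier A \<Longrightarrow> x \<notin> max_ideal p A \<Longrightarrow> x \<in> Units A"
    and char_B: "pelem p A [^]\<^bsub>A\<^esub> (n::nat) = \<zero>\<^bsub>A\<^esub> \<Longrightarrow> pelem p B [^]\<^bsub>B\<^esub> n = \<zero>\<^bsub>B\<^esub>"
    and complete: "padic_complete p B"
    and s: "t \<in> T1 \<union> T2 \<Longrightarrow> s t \<in> carrier A \<times> carrier B \<and> resA (fst (s t)) = t \<and> resB (snd (s t)) = Phi t"
    and D: "D \<subseteq> carrier k" "z \<in> carrier k \<Longrightarrow> z [^]\<^bsub>k\<^esub> p \<in> D" "T1 \<subseteq> D"
    and ind1: "finite S \<Longrightarrow> S \<subseteq> T1 \<Longrightarrow> t \<in> T1 - S \<Longrightarrow>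
      t \<notin> generate_field k ({x [^]\<^bsub>k\<^esub> p | x. x \<in> carrier k} \<union> S)"
    and ind2: "finite S \<Longrightarrow> S \<subseteq> T2 \<Longrightarrow> t \<in> T2 - S \<Longrightarrow> t \<notin> generate_field k (D \<union> S)"
    and full: "subring Y k \<Longrightarrow> (\<And>x. x \<in> carrier k \<Longrightarrow> x [^]\<^bsub>k\<^esub> p \<in> Y) \<Longrightarrow> T1 \<union> T2 \<subseteq> Y \<Longrightarrow> Y = carrier k"
begin

abbreviation Q :: "('a \<times> 'c) ring" where "Q \<equiv> RDirProd A B"

sublocale Q: cring Q
  using RDirProd_cring A.cring_axioms B.cring_axioms .

sublocale f: ring_hom_ring Q A fst
  by (rule ring_hom_ringI2[OF Q.ring_axioms A.ring_axioms fst_RDirProd_hom])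

sublocale g: ring_hom_ring Q B snd
  by (rule ring_hom_ringI2[OF Q.ring_axioms B.ring_axioms snd_RDirProd_hom])

abbreviation P :: "'a \<times> 'c" where "P \<equiv> pelem p Q"

lemma fst_P: "fst P = pelem p A" and snd_P: "snd P = pelem p B"
  using pelem_hom[OF fst_RDirProd_hom Q.ring_axioms A.ring_axioms]
    pelem_hom[OF snd_RDirProd_hom Q.ring_axioms B.ring_axioms] by blast+

lemma fst_P_pow: "fst (P [^]\<^bsub>Q\<^esub> (n::nat)) = pelem p A [^]\<^bsub>A\<^esub> n"
  and snd_P_pow: "snd (P [^]\<^bsub>Q\<^esub> (n::nat)) = pelem p B [^]\<^bsub>B\<^esub> n"
  using f.hom_nat_pow[of P n] g.hom_nat_pow[of P n] by (simp_all add: fst_P snd_P)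

lemma carrier_Q: "carrier Q = carrier A \<times> carrier B"
  by (rule RDirProd_carrier)

definition fiber_product :: "('a \<times> 'c) set" where
  "fiber_product = {g \<in> carrier Q. Phi (resA (fst g)) = resB (snd g)}"

text \<open>Residues are taken in \<open>k\<close>, where the independence hypotheses live; on the
  fibre product the residue of the second component is the image of this one under
  \<open>Phi\<close>.\<close>

definition resQ :: "'a \<times> 'c \<Rightarrow> 'b" where "resQ g = resA (fst g)"

lemma resQ_simps [simp]:
  "x \<in> carrier Q \<Longrightarrow> resQ x \<in> carrier k"
  "x \<in> carrier Q \<Longrightarrow> y \<in> carrier Q \<Longrightarrow> resQ (x \<oplus>\<^bsub>Q\<^esub> y) = resQ x \<oplus>\<^bsub>k\<^esub> resQ y"
  "x \<in> carrier Q \<Longrightarrow> y \<in> carrier Q \<Longrightarrow> resQ (x \<otimes>\<^bsub>Q\<^esub> y) = resQ x \<otimes>\<^bsub>k\<^esub> resQ y"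
  "x \<in> carrier Q \<Longrightarrow> resQ (\<ominus>\<^bsub>Q\<^esub> x) = \<ominus>\<^bsub>k\<^esub> resQ x"
  "x \<in> carrier Q \<Longrightarrow> resQ (x [^]\<^bsub>Q\<^esub> (n::nat)) = resQ x [^]\<^bsub>k\<^esub> n"
  "resQ \<one>\<^bsub>Q\<^esub> = \<one>\<^bsub>k\<^esub>" "resQ \<zero>\<^bsub>Q\<^esub> = \<zero>\<^bsub>k\<^esub>"
  unfolding resQ_def by (simp_all add: f.hom_nat_pow rA.hom_nat_pow)

sublocale r: ring_hom_ring Q k resQ
  by (intro ring_hom_ringI2 Q.ring_axioms k.ring_axioms ring_hom_memI) auto

lemma res_pelem: "resA (pelem p A) = \<zero>\<^bsub>k\<^esub>" "resB (pelem p B) = \<zero>\<^bsub>l\<^esub>"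
proof -
  have "pelem p A \<in> max_ideal p A" unfolding A.max_ideal_iff by (rule bexI[of _ "\<one>\<^bsub>A\<^esub>"]) auto
  then show "resA (pelem p A) = \<zero>\<^bsub>k\<^esub>" using kerA by simp
  have "pelem p B \<in> max_ideal p B" unfolding B.max_ideal_iff by (rule bexI[of _ "\<one>\<^bsub>B\<^esub>"]) auto
  then show "resB (pelem p B) = \<zero>\<^bsub>l\<^esub>" using kerB by simp
qed

lemma char_k: "pelem p k = \<zero>\<^bsub>k\<^esub>"
  using pelem_hom[OF rA.homh A.ring_axioms k.ring_axioms, of p] res_pelem by simp

lemma one_notin_max_ideal: "\<one>\<^bsub>A\<^esub> \<notin> max_ideal p A"
  using kerA[of "\<one>\<^bsub>A\<^esub>"] by simp

lemma resQ_P: "resQ P = \<zero>\<^bsub>k\<^esub>"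
  unfolding resQ_def by (simp add: fst_P res_pelem)

text \<open>A level-\<open>n\<close> approximation is the full preimage of the graph of a ring homomorphism from
  \<open>A\<close> to \<open>B/p^n\<close> with the prescribed residue map and the prescribed values on \<open>s\<close>.\<close>

definition level :: "nat \<Rightarrow> ('a \<times> 'c) set \<Rightarrow> bool" where
  "level n G \<longleftrightarrow> subring G Q \<and> G \<subseteq> fiber_product \<and> (\<forall>q\<in>carrier Q. P [^]\<^bsub>Q\<^esub> n \<otimes>\<^bsub>Q\<^esub> q \<in> G) \<and>
     fst ` G = carrier A \<and> (\<forall>x\<in>G. fst x \<in> padic_ideal p A n \<longrightarrow> snd x \<in> padic_ideal p B n) \<and>
     s ` (T1 \<union> T2) \<subseteq> G"

definition err_ideal :: "nat \<Rightarrow> ('a \<times> 'c) set \<Rightarrow> ('a \<times> 'c) set" where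
  "err_ideal n G = {P \<otimes>\<^bsub>Q\<^esub> x \<oplus>\<^bsub>Q\<^esub> P [^]\<^bsub>Q\<^esub> Suc n \<otimes>\<^bsub>Q\<^esub> q | x q. x \<in> G \<and> q \<in> carrier Q}"

text \<open>A homomorphism known modulo \<open>p^n\<close> has its values on \<open>p\<close>-th
  powers and on multiples of \<open>p\<close> determined modulo \<open>p^(n+1)\<close>; the values
  on representatives are prescribed. These are the three kinds of generators.\<close>

definition refine :: "nat \<Rightarrow> ('a \<times> 'c) set \<Rightarrow> ('a \<times> 'c) set" where
  "refine n G = generate_ring Q (({x [^]\<^bsub>Q\<^esub> p | x. x \<in> G} \<union> err_ideal n G) \<union> s ` (T1 \<union> T2))"

lemma fiber_product_subring: "subring fiber_product Q"
  by (rule Q.subringI) (auto simp: fiber_product_def)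

text \<open>Modulo \<open>p\<close> there is nothing to choose: the homomorphism is
  \<open>Phi\<close> on residues, and surjectivity of \<open>resB\<close> supplies second
  components.\<close>

lemma level_fiber_product: "level 1 fiber_product"
  unfolding level_def
proof (intro conjI ballI impI)
  show "subring fiber_product Q" by (rule fiber_product_subring)
  show "fiber_product \<subseteq> fiber_product" ..
  show "P [^]\<^bsub>Q\<^esub> (1::nat) \<otimes>\<^bsub>Q\<^esub> q \<in> fiber_product" if "q \<in> carrier Q" for q
    using that unfolding fiber_product_def by (simp add: fst_P snd_P res_pelem)
  show "fst ` fiber_product = carrier A"
  proof (intro subset_antisym subsetI)
    fix a assume a: "a \<in> carrier A"
    then have "Phi (resA a) \<in> carrier l" by simp
    then obtain b where "b \<in> carrier B" "resB b = Phi (resA a)" using surjB by (metis imageE)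
    then have "(a, b) \<in> fiber_product" using a by (simp add: fiber_product_def carrier_Q)
    then show "a \<in> fst ` fiber_product" by force
  qed (auto simp: fiber_product_def carrier_Q)
  show "snd x \<in> padic_ideal p B 1" if "x \<in> fiber_product" "fst x \<in> padic_ideal p A 1" for x
  proof -
    have x: "fst x \<in> carrier A" "snd x \<in> carrier B" "Phi (resA (fst x)) = resB (snd x)"
      using that(1) by (auto simp: fiber_product_def)
    have "fst x \<in> max_ideal p A"
      using that(2) by (simp add: A.padic_ideal_iff A.max_ideal_iff)
    then have "resB (snd x) = \<zero>\<^bsub>l\<^esub>" using kerA[OF x(1)] x(3) by simp
    then show ?thesis using kerB[OF x(2)] by (simp add: B.padic_ideal_iff B.max_ideal_iff)
  qed
  show "s ` (T1 \<union> T2) \<subseteq> fiber_product"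
    by (rule image_subsetI) (use s in \<open>simp add: fiber_product_def carrier_Q\<close>)
qed

end

section \<open>One refinement step, from level \<open>n\<close> to level
  \<open>n + 1\<close>\<close>

locale lifting_level = lifting_data +
  fixes n :: nat and G
  assumes n: "n \<ge> 1" and lev: "level n G"
begin

lemma G_subring: "subring G Q" and G_fiber: "G \<subseteq> fiber_product" and G_pow: "q \<in> carrier Q \<Longrightarrow> P [^]\<^bsub>Q\<^esub> n \<otimes>\<^bsub>Q\<^esub> q \<in> G"
  and G_fst: "fst ` G = carrier A"
  and G_fun: "x \<in> G \<Longrightarrow> fst x \<in> padic_ideal p A n \<Longrightarrow> snd x \<in> padic_ideal p B n"
  and G_s: "s ` (T1 \<union> T2) \<subseteq> G"
  using lev unfolding level_def by auto

lemmas G_mem = subringE(2,3,5-7)[OF G_subring]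

lemma G_carrier: "x \<in> G \<Longrightarrow> x \<in> carrier Q"
  using subringE(1)[OF G_subring] by blast

lemma G_power: "x \<in> G \<Longrightarrow> x [^]\<^bsub>Q\<^esub> (m::nat) \<in> G"
  by (induction m) (auto simp: G_mem)

lemma P_in_G: "P \<in> G"
proof -
  have "pelem p (Q\<lparr>carrier := G\<rparr>) \<in> carrier (Q\<lparr>carrier := G\<rparr>)"
    using ring.pelem_closed[OF Q.subring_is_ring[OF G_subring]] .
  then show ?thesis by (simp add: Q.pelem_subring)
qed

lemma err_idealI: "x \<in> G \<Longrightarrow> q \<in> carrier Q \<Longrightarrow> P \<otimes>\<^bsub>Q\<^esub> x \<oplus>\<^bsub>Q\<^esub> P [^]\<^bsub>Q\<^esub> Suc n \<otimes>\<^bsub>Q\<^esub> q \<in> err_ideal n G"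
  unfolding err_ideal_def by blast

lemma err_ideal_subset: "err_ideal n G \<subseteq> G"
proof
  fix j assume "j \<in> err_ideal n G"
  then obtain x q where x: "x \<in> G" "q \<in> carrier Q"
    "j = P \<otimes>\<^bsub>Q\<^esub> x \<oplus>\<^bsub>Q\<^esub> P [^]\<^bsub>Q\<^esub> Suc n \<otimes>\<^bsub>Q\<^esub> q" unfolding err_ideal_def by blast
  have "P [^]\<^bsub>Q\<^esub> Suc n \<otimes>\<^bsub>Q\<^esub> q = P [^]\<^bsub>Q\<^esub> n \<otimes>\<^bsub>Q\<^esub> (P \<otimes>\<^bsub>Q\<^esub> q)" using x by (simp add: Q.m_assoc)
  then show "j \<in> G" using x G_mem P_in_G G_pow[of "P \<otimes>\<^bsub>Q\<^esub> q"] by simp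
qed

lemma err_ideal_add:
  assumes "a \<in> err_ideal n G" "b \<in> err_ideal n G"
  shows "a \<oplus>\<^bsub>Q\<^esub> b \<in> err_ideal n G"
proof -
  obtain x q y r where x: "x \<in> G" "q \<in> carrier Q" "a = P \<otimes>\<^bsub>Q\<^esub> x \<oplus>\<^bsub>Q\<^esub> P [^]\<^bsub>Q\<^esub> Suc n \<otimes>\<^bsub>Q\<^esub> q"
    and y: "y \<in> G" "r \<in> carrier Q" "b = P \<otimes>\<^bsub>Q\<^esub> y \<oplus>\<^bsub>Q\<^esub> P [^]\<^bsub>Q\<^esub> Suc n \<otimes>\<^bsub>Q\<^esub> r"
    using assms unfolding err_ideal_def by blast
  have "a \<oplus>\<^bsub>Q\<^esub> b = P \<otimes>\<^bsub>Q\<^esub> (x \<oplus>\<^bsub>Q\<^esub> y) \<oplus>\<^bsub>Q\<^esub> P [^]\<^bsub>Q\<^esub> Suc n \<otimes>\<^bsub>Q\<^esub> (q \<oplus>\<^bsub>Q\<^esub> r)"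
    unfolding x(3) y(3) using G_carrier x y by (simp add: Q.r_distr Q.a_ac del: nat_pow_Suc)
  then show ?thesis using err_idealI[of "x \<oplus>\<^bsub>Q\<^esub> y" "q \<oplus>\<^bsub>Q\<^esub> r"] x y G_mem by simp
qed

lemma err_ideal_mult:
  assumes "y \<in> G" "a \<in> err_ideal n G"
  shows "y \<otimes>\<^bsub>Q\<^esub> a \<in> err_ideal n G"
proof -
  obtain x q where x: "x \<in> G" "q \<in> carrier Q" "a = P \<otimes>\<^bsub>Q\<^esub> x \<oplus>\<^bsub>Q\<^esub> P [^]\<^bsub>Q\<^esub> Suc n \<otimes>\<^bsub>Q\<^esub> q"
    using assms unfolding err_ideal_def by blast
  have "y \<otimes>\<^bsub>Q\<^esub> a = P \<otimes>\<^bsub>Q\<^esub> (y \<otimes>\<^bsub>Q\<^esub> x) \<oplus>\<^bsub>Q\<^esub> P [^]\<^bsub>Q\<^esub> Suc n \<otimes>\<^bsub>Q\<^esub> (y \<otimes>\<^bsub>Q\<^esub> q)"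
    unfolding x(3) using G_carrier assms(1) x by (simp add: Q.r_distr Q.m_ac del: nat_pow_Suc)
  then show ?thesis using err_idealI[of "y \<otimes>\<^bsub>Q\<^esub> x" "y \<otimes>\<^bsub>Q\<^esub> q"] x assms(1) G_mem G_carrier by simp
qed

lemma err_ideal_mult_right:
  assumes "a \<in> err_ideal n G" "y \<in> G"
  shows "a \<otimes>\<^bsub>Q\<^esub> y \<in> err_ideal n G"
proof -
  have "a \<in> carrier Q" "y \<in> carrier Q" using assms err_ideal_subset G_carrier by blast+
  then show ?thesis using err_ideal_mult[OF assms(2,1)] Q.m_comm by simp
qed

lemma P_mult_err_ideal: "x \<in> G \<Longrightarrow> P \<otimes>\<^bsub>Q\<^esub> x \<in> err_ideal n G"
  using err_idealI[of x "\<zero>\<^bsub>Q\<^esub>"] G_carrier[of x] by simp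

lemma P_pow_err_ideal: "q \<in> carrier Q \<Longrightarrow> P [^]\<^bsub>Q\<^esub> Suc n \<otimes>\<^bsub>Q\<^esub> q \<in> err_ideal n G"
  using err_idealI[of "\<zero>\<^bsub>Q\<^esub>" q] G_mem by simp

text \<open>The first component of \<open>x\<close> is \<open>p a\<close>. Subtracting
  \<open>P\<close> times an element of \<open>G\<close> over \<open>a\<close> leaves a first
  component zero, so the second component is a multiple of \<open>p^n\<close> by
  \<open>G_fun\<close>.\<close>

lemma ker_decompose:
  assumes x: "x \<in> G" "resQ x = \<zero>\<^bsub>k\<^esub>"
  shows "\<exists>y\<in>G. \<exists>q\<in>carrier Q. x = P \<otimes>\<^bsub>Q\<^esub> y \<oplus>\<^bsub>Q\<^esub> P [^]\<^bsub>Q\<^esub> n \<otimes>\<^bsub>Q\<^esub> q"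
proof -
  have xc: "x \<in> carrier Q" using G_carrier x by blast
  then have "fst x \<in> max_ideal p A" using kerA x(2) by (simp add: resQ_def)
  then obtain a where a: "a \<in> carrier A" "fst x = pelem p A \<otimes>\<^bsub>A\<^esub> a" by (auto simp: A.max_ideal_iff)
  obtain y where y: "y \<in> G" "fst y = a" using a(1) G_fst by (metis imageE)
  have yc: "y \<in> carrier Q" using G_carrier y by blast
  define d where "d = x \<oplus>\<^bsub>Q\<^esub> \<ominus>\<^bsub>Q\<^esub> (P \<otimes>\<^bsub>Q\<^esub> y)"
  have d: "d \<in> G" unfolding d_def using x y P_in_G G_mem by simp
  have dc: "d \<in> carrier Q" using G_carrier d by blast
  have fd: "fst d = \<zero>\<^bsub>A\<^esub>" unfolding d_def using xc yc y a by (simp add: fst_P A.r_neg)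
  then have "fst d \<in> padic_ideal p A n" unfolding A.padic_ideal_iff
    by (intro bexI[of _ "\<zero>\<^bsub>A\<^esub>"]) auto
  then obtain b where b: "b \<in> carrier B" "snd d = pelem p B [^]\<^bsub>B\<^esub> n \<otimes>\<^bsub>B\<^esub> b"
    using G_fun[OF d] by (auto simp: B.padic_ideal_iff)
  have q: "(\<zero>\<^bsub>A\<^esub>, b) \<in> carrier Q" using b by (simp add: carrier_Q)
  have "d = P [^]\<^bsub>Q\<^esub> n \<otimes>\<^bsub>Q\<^esub> (\<zero>\<^bsub>A\<^esub>, b)"
    using q fd b by (intro prod_eqI) (simp_all add: fst_P_pow snd_P_pow)
  moreover have "x = P \<otimes>\<^bsub>Q\<^esub> y \<oplus>\<^bsub>Q\<^esub> d"
    unfolding d_def using xc yc by (simp add: Q.a_ac Q.r_neg1 Q.r_neg2 Q.a_lcomm Q.r_neg)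
  ultimately show ?thesis using y q by blast
qed

text \<open>Expand the \<open>p\<close>-th power of the sum from \<open>ker_decompose\<close>. The
  first summand contributes \<open>P\<close> times an element of \<open>G\<close>, the mixed terms
  carry \<open>P\<close> times \<open>P^n\<close>, and the second summand carries
  \<open>P^(n p)\<close>, where \<open>n p\<close> is at least \<open>n + 1\<close> because
  \<open>n \<ge> 1\<close> and \<open>p \<ge> 2\<close>.\<close>

lemma ker_power_err_ideal:
  assumes x: "x \<in> G" "resQ x = \<zero>\<^bsub>k\<^esub>"
  shows "x [^]\<^bsub>Q\<^esub> p \<in> err_ideal n G"
proof -
  obtain y q where y: "y \<in> G" "q \<in> carrier Q" "x = P \<otimes>\<^bsub>Q\<^esub> y \<oplus>\<^bsub>Q\<^esub> P [^]\<^bsub>Q\<^esub> n \<otimes>\<^bsub>Q\<^esub> q"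
    using ker_decompose[OF x] by blast
  have yc: "y \<in> carrier Q" using G_carrier y by blast
  let ?u = "P \<otimes>\<^bsub>Q\<^esub> y" and ?v = "P [^]\<^bsub>Q\<^esub> n \<otimes>\<^bsub>Q\<^esub> q"
  have u: "?u \<in> carrier Q" "?v \<in> carrier Q" using yc y by auto
  obtain z where z: "z \<in> carrier Q" "(?u \<oplus>\<^bsub>Q\<^esub> ?v) [^]\<^bsub>Q\<^esub> p =
      ?u [^]\<^bsub>Q\<^esub> p \<oplus>\<^bsub>Q\<^esub> ?v [^]\<^bsub>Q\<^esub> p \<oplus>\<^bsub>Q\<^esub> P \<otimes>\<^bsub>Q\<^esub> (?v \<otimes>\<^bsub>Q\<^esub> z)"
    using Q.prime_power_of_sum[OF prime u] .
  obtain m where m: "p = Suc (Suc m)"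
    using prime_ge_2_nat[OF prime] by (metis Suc_1 add_2_eq_Suc le_add_diff_inverse)
  have "?u [^]\<^bsub>Q\<^esub> p = P \<otimes>\<^bsub>Q\<^esub> (P [^]\<^bsub>Q\<^esub> Suc m \<otimes>\<^bsub>Q\<^esub> y [^]\<^bsub>Q\<^esub> p)"
    using yc by (simp add: Q.nat_pow_distrib m Q.m_ac)
  moreover have "P [^]\<^bsub>Q\<^esub> Suc m \<otimes>\<^bsub>Q\<^esub> y [^]\<^bsub>Q\<^esub> p \<in> G"
    by (intro G_mem(4) G_power P_in_G y(1))
  ultimately have 1: "?u [^]\<^bsub>Q\<^esub> p \<in> err_ideal n G" using P_mult_err_ideal by simp
  have "Suc n \<le> n * p" using n m by (simp add: trans_le_add1)
  then obtain d where d: "n * p = Suc n + d" using le_Suc_ex by blast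
  have "?v [^]\<^bsub>Q\<^esub> p = P [^]\<^bsub>Q\<^esub> (n * p) \<otimes>\<^bsub>Q\<^esub> q [^]\<^bsub>Q\<^esub> p"
    using y by (simp add: Q.nat_pow_distrib Q.nat_pow_pow)
  also have "\<dots> = P [^]\<^bsub>Q\<^esub> Suc n \<otimes>\<^bsub>Q\<^esub> (P [^]\<^bsub>Q\<^esub> d \<otimes>\<^bsub>Q\<^esub> q [^]\<^bsub>Q\<^esub> p)"
    unfolding d using y by (simp add: Q.nat_pow_mult[symmetric] Q.m_ac del: nat_pow_Suc)
  finally have 2: "?v [^]\<^bsub>Q\<^esub> p \<in> err_ideal n G" using P_pow_err_ideal y by (simp del: nat_pow_Suc)
  have "P \<otimes>\<^bsub>Q\<^esub> (?v \<otimes>\<^bsub>Q\<^esub> z) = P [^]\<^bsub>Q\<^esub> Suc n \<otimes>\<^bsub>Q\<^esub> (q \<otimes>\<^bsub>Q\<^esub> z)"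
    using y z by (simp add: Q.m_ac)
  then have 3: "P \<otimes>\<^bsub>Q\<^esub> (?v \<otimes>\<^bsub>Q\<^esub> z) \<in> err_ideal n G" using P_pow_err_ideal y z by (simp del: nat_pow_Suc)
  show ?thesis unfolding y(3) z(2) by (intro err_ideal_add 1 2 3)
qed

lemma resQ_err_ideal: "j \<in> err_ideal n G \<Longrightarrow> resQ j = \<zero>\<^bsub>k\<^esub>"
  unfolding err_ideal_def using G_carrier by (auto simp: resQ_P)

sublocale F: frobenius_ideal "Q\<lparr>carrier := G\<rparr>" k resQ p "err_ideal n G"
proof -
  interpret R: cring "Q\<lparr>carrier := G\<rparr>"
    using Q.subcring_iff Q.subcringI'[OF G_subring] subringE(1)[OF G_subring] by blast
  have id: "ideal (err_ideal n G) (Q\<lparr>carrier := G\<rparr>)"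
  proof (rule idealI[OF R.ring_axioms])
    show "subgroup (err_ideal n G) (add_monoid (Q\<lparr>carrier := G\<rparr>))"
    proof (rule R.add.subgroupI)
      show "err_ideal n G \<subseteq> carrier (Q\<lparr>carrier := G\<rparr>)" using err_ideal_subset by simp
      show "err_ideal n G \<noteq> {}" using P_mult_err_ideal P_in_G by blast
      fix a assume a: "a \<in> err_ideal n G"
      then have aG: "a \<in> G" using err_ideal_subset by blast
      have "\<ominus>\<^bsub>Q\<lparr>carrier := G\<rparr>\<^esub> a = (\<ominus>\<^bsub>Q\<lparr>carrier := G\<rparr>\<^esub> \<one>\<^bsub>Q\<^esub>) \<otimes>\<^bsub>Q\<^esub> a"
        using R.l_minus[of "\<one>\<^bsub>Q\<^esub>" a] aG G_mem G_carrier by simp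
      then show "\<ominus>\<^bsub>Q\<lparr>carrier := G\<rparr>\<^esub> a \<in> err_ideal n G"
        using err_ideal_mult[of "\<ominus>\<^bsub>Q\<lparr>carrier := G\<rparr>\<^esub> \<one>\<^bsub>Q\<^esub>" a] a R.a_inv_closed[of "\<one>\<^bsub>Q\<^esub>"] G_mem by simp
    qed (use err_ideal_add in simp)
  qed (use err_ideal_mult err_ideal_mult_right in simp_all)
  show "frobenius_ideal (Q\<lparr>carrier := G\<rparr>) k resQ p (err_ideal n G)"
  proof (intro frobenius_ideal.intro frobenius_ideal_axioms.intro R.cring_axioms k.field_axioms prime char_k id)
    show "ring_hom_ring (Q\<lparr>carrier := G\<rparr>) k resQ"
      using G_carrier by (intro ring_hom_ringI2 R.ring_axioms k.ring_axioms ring_hom_memI) auto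
    show "pelem p (Q\<lparr>carrier := G\<rparr>) \<in> err_ideal n G"
      using P_mult_err_ideal[of "\<one>\<^bsub>Q\<^esub>"] G_mem by (simp add: Q.pelem_subring)
    show "x [^]\<^bsub>Q\<lparr>carrier := G\<rparr>\<^esub> p \<in> err_ideal n G"
      if "x \<in> carrier (Q\<lparr>carrier := G\<rparr>)" "resQ x = \<zero>\<^bsub>k\<^esub>" for x
      using that ker_power_err_ideal by (simp add: Q.nat_pow_consistent[symmetric])
  qed
qed


lemma refine_gens_subset: "({x [^]\<^bsub>Q\<^esub> p | x. x \<in> G} \<union> err_ideal n G) \<union> s ` (T1 \<union> T2) \<subseteq> G"
  using G_power err_ideal_subset G_s by blast

lemma refine_gens_carrier: "({x [^]\<^bsub>Q\<^esub> p | x. x \<in> G} \<union> err_ideal n G) \<union> s ` (T1 \<union> T2) \<subseteq> carrier Q"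
  using refine_gens_subset G_carrier by blast

lemma refine_subring: "subring (refine n G) Q"
  unfolding refine_def by (rule Q.generate_ring_is_subring[OF refine_gens_carrier])

lemma refine_subset: "refine n G \<subseteq> G"
  unfolding refine_def
  by (rule Q.generate_ring_min_subring1[OF refine_gens_carrier G_subring refine_gens_subset])

lemma power_in_refine: "x \<in> G \<Longrightarrow> x [^]\<^bsub>Q\<^esub> p \<in> refine n G"
  and err_in_refine: "j \<in> err_ideal n G \<Longrightarrow> j \<in> refine n G"
  and s_in_refine: "t \<in> T1 \<union> T2 \<Longrightarrow> s t \<in> refine n G"
  unfolding refine_def by (rule generate_ring.incl; blast)+

text \<open>This is where \<open>p\<close>-independence enters. By finite support only finitely many
  representatives matter. They are adjoined to \<open>powers_mod\<close> in two stages, first those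
  over \<open>T1\<close>, then those over \<open>T2\<close>, and no stage creates new elements of
  residue zero outside \<open>err_ideal n G\<close>.\<close>

lemma refine_ker:
  assumes x: "x \<in> refine n G" "resQ x = \<zero>\<^bsub>k\<^esub>"
  shows "x \<in> err_ideal n G"
proof -
  let ?H = "{x [^]\<^bsub>Q\<^esub> p | x. x \<in> G} \<union> err_ideal n G"
  let ?kp = "{x [^]\<^bsub>k\<^esub> p | x. x \<in> carrier k}"
  obtain S where S: "finite S" "S \<subseteq> T1 \<union> T2" "x \<in> generate_ring Q (?H \<union> s ` S)"
    using Q.generate_ring_finite_support[of ?H s "T1 \<union> T2" x] refine_gens_carrier x(1)
    unfolding refine_def by auto
  have kp: "?kp \<subseteq> carrier k" by auto
  have s': "s t \<in> carrier (Q\<lparr>carrier := G\<rparr>) \<and> resQ (s t) = t" if "t \<in> T1 \<union> T2" for t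
    using that G_s s[OF that] by (auto simp: resQ_def)
  have pm: "resQ ` F.powers_mod \<subseteq> generate_field k ?kp"
  proof clarify
    fix a assume "a \<in> F.powers_mod"
    then obtain y j where y: "y \<in> G" "j \<in> err_ideal n G" "a = y [^]\<^bsub>Q\<^esub> p \<oplus>\<^bsub>Q\<^esub> j"
      unfolding F.powers_mod_def by (auto simp: Q.nat_pow_consistent[symmetric])
    have c: "y \<in> carrier Q" "j \<in> carrier Q" using y err_ideal_subset G_carrier by blast+
    then have "resQ a = resQ y [^]\<^bsub>k\<^esub> p" using y resQ_err_ideal[OF y(2)] by simp
    then show "resQ a \<in> generate_field k ?kp" using c by (auto intro!: generate_field.incl)
  qed
  obtain Z1 where Z1: "subring Z1 (Q\<lparr>carrier := G\<rparr>)" "F.powers_mod \<subseteq> Z1" "s ` (S \<inter> T1) \<subseteq> Z1"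
    "resQ ` Z1 \<subseteq> generate_field k (?kp \<union> S \<inter> T1)" "\<forall>z\<in>Z1. resQ z = \<zero>\<^bsub>k\<^esub> \<longrightarrow> z \<in> err_ideal n G"
  proof -
    have "\<exists>Z. subring Z (Q\<lparr>carrier := G\<rparr>) \<and> F.powers_mod \<subseteq> Z \<and> s ` (S \<inter> T1) \<subseteq> Z \<and>
        resQ ` Z \<subseteq> generate_field k (?kp \<union> S \<inter> T1) \<and> (\<forall>z\<in>Z. resQ z = \<zero>\<^bsub>k\<^esub> \<longrightarrow> z \<in> err_ideal n G)"
      by (rule F.adjoin_finite[OF F.powers_mod_subring subset_refl
            F.powers_mod_ker[OF resQ_err_ideal] kp pm _ _ s' ind1]) (use S(1) in auto)
    then show ?thesis using that by blast
  qed
  \<comment> \<open>The base changes here: \<open>p\<close>-th powers and \<open>T1\<close> lie in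
    \<open>D\<close>, over which the elements of \<open>T2\<close> are independent.\<close>
  have Z1D: "resQ ` Z1 \<subseteq> generate_field k D"
    using Z1(4) k.mono_generate_field[of "?kp \<union> S \<inter> T1" D] D by blast
  obtain Z2 where Z2: "subring Z2 (Q\<lparr>carrier := G\<rparr>)" "Z1 \<subseteq> Z2" "s ` (S \<inter> T2) \<subseteq> Z2"
    "\<forall>z\<in>Z2. resQ z = \<zero>\<^bsub>k\<^esub> \<longrightarrow> z \<in> err_ideal n G"
  proof -
    have "\<exists>Z. subring Z (Q\<lparr>carrier := G\<rparr>) \<and> Z1 \<subseteq> Z \<and> s ` (S \<inter> T2) \<subseteq> Z \<and>
        resQ ` Z \<subseteq> generate_field k (D \<union> S \<inter> T2) \<and> (\<forall>z\<in>Z. resQ z = \<zero>\<^bsub>k\<^esub> \<longrightarrow> z \<in> err_ideal n G)"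
      by (rule F.adjoin_finite[OF Z1(1,2) _ D(1) Z1D _ _ s' ind2]) (use S(1) Z1(5) in auto)
    then show ?thesis using that by blast
  qed
  have "?H \<subseteq> F.powers_mod"
  proof
    fix a assume "a \<in> ?H"
    then consider y where "y \<in> G" "a = y [^]\<^bsub>Q\<^esub> p" | "a \<in> err_ideal n G" by blast
    then show "a \<in> F.powers_mod"
    proof cases
      case 1
      then show ?thesis using F.powers_modI[of y "\<zero>\<^bsub>Q\<^esub>"] F.J_mem(2) G_carrier
        by (simp add: Q.nat_pow_consistent[symmetric])
    next
      case 2
      then have "a \<in> carrier Q" using err_ideal_subset G_carrier by blast
      then show ?thesis using F.powers_modI[of "\<zero>\<^bsub>Q\<^esub>" a] 2 G_mem prime_gt_0_nat[OF prime]
        by (simp add: Q.nat_pow_consistent[symmetric] Q.nat_pow_zero)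
    qed
  qed
  then have "?H \<subseteq> Z2" using Z1(2) Z2(2) by (meson subset_trans)
  moreover have "s ` S \<subseteq> Z2"
  proof (rule image_subsetI)
    fix t assume "t \<in> S"
    then consider "t \<in> S \<inter> T1" | "t \<in> S \<inter> T2" using S(2) by blast
    then show "s t \<in> Z2" by cases (use Z1(3) Z2(2,3) in auto)
  qed
  ultimately have sub: "?H \<union> s ` S \<subseteq> Z2" by (rule Un_least)
  have Z2Q: "subring Z2 Q" using Q.subring_of_subring[OF G_subring Z2(1)] .
  have "generate_ring Q (?H \<union> s ` S) \<subseteq> Z2"
    by (rule Q.generate_ring_min_subring1[OF subset_trans[OF sub subringE(1)[OF Z2Q]] Z2Q sub])
  then show ?thesis using S(3) Z2(4) x(2) by blast
qed

text \<open>The image is a subring of \<open>k\<close> containing \<open>T1 \<union> T2\<close> and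
  all \<open>p\<close>-th powers, the latter because every residue is attained on \<open>G\<close>;
  so \<open>full\<close> applies.\<close>

lemma refine_residues: "resQ ` refine n G = carrier k"
proof (rule full)
  show "subring (resQ ` refine n G) k" by (rule r.img_is_subring[OF refine_subring])
  show "y [^]\<^bsub>k\<^esub> p \<in> resQ ` refine n G" if y: "y \<in> carrier k" for y
  proof -
    obtain a where a: "y = resA a" "a \<in> carrier A" using y unfolding surjA[symmetric] by (rule imageE)
    obtain x where x: "a = fst x" "x \<in> G" using a(2) unfolding G_fst[symmetric] by (rule imageE)
    have "y [^]\<^bsub>k\<^esub> p = resQ (x [^]\<^bsub>Q\<^esub> p)" using G_carrier[OF x(2)] x(1) a(1) by (simp add: resQ_def[of x])
    then show ?thesis using power_in_refine[OF x(2)] by (rule image_eqI)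
  qed
  show "T1 \<union> T2 \<subseteq> resQ ` refine n G"
  proof
    fix t assume t: "t \<in> T1 \<union> T2"
    then have "t = resQ (s t)" using s by (simp add: resQ_def)
    then show "t \<in> resQ ` refine n G" using s_in_refine[OF t] by (rule image_eqI)
  qed
qed

text \<open>Meant for graphs \<open>H\<close> of homomorphisms. By \<open>gen\<close>, every
  \<open>h\<close> in \<open>H\<close> has the residue of some \<open>y\<close> in \<open>H\<close>
  that survives the refinement. By \<open>div\<close>, the difference is \<open>P\<close> times an
  element of \<open>H\<close>, hence in \<open>err_ideal n G\<close>, and so \<open>h\<close>
  survives too.\<close>

lemma refine_contains:
  assumes H: "subring H Q" "H \<subseteq> G"
    and div: "\<And>h. h \<in> H \<Longrightarrow> resQ h = \<zero>\<^bsub>k\<^esub> \<Longrightarrow> \<exists>h'\<in>H. h = P \<otimes>\<^bsub>Q\<^esub> h'"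
    and gen: "\<And>Y. subring Y k \<Longrightarrow> (\<And>h. h \<in> H \<Longrightarrow> resQ h [^]\<^bsub>k\<^esub> p \<in> Y) \<Longrightarrow>
      (\<And>t. t \<in> T1 \<union> T2 \<Longrightarrow> s t \<in> H \<Longrightarrow> t \<in> Y) \<Longrightarrow> resQ ` H \<subseteq> Y"
  shows "H \<subseteq> refine n G"
proof
  fix h assume h: "h \<in> H"
  have Hpow: "x [^]\<^bsub>Q\<^esub> (m::nat) \<in> H" if "x \<in> H" for x m
    using that by (induction m) (auto simp: subringE(3,6)[OF H(1)])
  have "resQ ` H \<subseteq> resQ ` (H \<inter> refine n G)"
  proof (rule gen)
    show "subring (resQ ` (H \<inter> refine n G)) k"
      by (rule r.img_is_subring[OF Q.subring_inter[OF H(1) refine_subring]])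
    fix x assume x: "x \<in> H"
    then have "x \<in> carrier Q" using H(2) G_carrier by blast
    then have "resQ x [^]\<^bsub>k\<^esub> p = resQ (x [^]\<^bsub>Q\<^esub> p)" by simp
    moreover have "x [^]\<^bsub>Q\<^esub> p \<in> H \<inter> refine n G" using x H(2) Hpow power_in_refine by blast
    ultimately show "resQ x [^]\<^bsub>k\<^esub> p \<in> resQ ` (H \<inter> refine n G)" by (rule image_eqI)
  next
    fix t assume t: "t \<in> T1 \<union> T2" "s t \<in> H"
    then have "t = resQ (s t)" using s by (simp add: resQ_def)
    moreover have "s t \<in> H \<inter> refine n G" using t s_in_refine by blast
    ultimately show "t \<in> resQ ` (H \<inter> refine n G)" by (rule image_eqI)
  qed
  then have "resQ h \<in> resQ ` (H \<inter> refine n G)" using h by blast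
  then obtain y where "resQ h = resQ y" "y \<in> H \<inter> refine n G" by (rule imageE)
  then have y: "y \<in> H" "y \<in> refine n G" "resQ y = resQ h" by auto
  have c: "h \<in> carrier Q" "y \<in> carrier Q" using h y H G_carrier by blast+
  have "h \<oplus>\<^bsub>Q\<^esub> \<ominus>\<^bsub>Q\<^esub> y \<in> H" using h y subringE(5,7)[OF H(1)] by blast
  moreover have "resQ (h \<oplus>\<^bsub>Q\<^esub> \<ominus>\<^bsub>Q\<^esub> y) = \<zero>\<^bsub>k\<^esub>" using c y by (simp add: k.r_neg)
  ultimately obtain z where z: "z \<in> H" "h \<oplus>\<^bsub>Q\<^esub> \<ominus>\<^bsub>Q\<^esub> y = P \<otimes>\<^bsub>Q\<^esub> z" using div by blast
  have "P \<otimes>\<^bsub>Q\<^esub> z \<in> refine n G" using P_mult_err_ideal err_in_refine z H by blast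
  then have "P \<otimes>\<^bsub>Q\<^esub> z \<oplus>\<^bsub>Q\<^esub> y \<in> refine n G" using y subringE(7)[OF refine_subring] by blast
  then show "h \<in> refine n G" using c unfolding z(2)[symmetric] by (simp add: Q.a_assoc Q.l_neg)
qed

lemma refine_level: "level (Suc n) (refine n G)"
  unfolding level_def
proof (intro conjI ballI impI)
  show "subring (refine n G) Q" by (rule refine_subring)
  show "refine n G \<subseteq> fiber_product" using refine_subset G_fiber by blast
  show "P [^]\<^bsub>Q\<^esub> Suc n \<otimes>\<^bsub>Q\<^esub> q \<in> refine n G" if "q \<in> carrier Q" for q
    using err_in_refine[OF P_pow_err_ideal[OF that]] .
  show "s ` (T1 \<union> T2) \<subseteq> refine n G" using s_in_refine by blast
  show "fst ` refine n G = carrier A"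
  proof (intro subset_antisym subsetI)
    fix a assume "a \<in> fst ` refine n G"
    then obtain x where "a = fst x" "x \<in> refine n G" by (rule imageE)
    then show "a \<in> carrier A" using refine_subset G_carrier f.hom_closed by blast
  next
    \<comment> \<open>The residue of \<open>a\<close> is matched by some \<open>y\<close> in the
      refinement. The remaining difference is \<open>p b\<close>, and \<open>P\<close> times an
      element of \<open>G\<close> over \<open>b\<close> is in the error ideal.\<close>
    fix a assume a: "a \<in> carrier A"
    have "resA a \<in> resQ ` refine n G" using refine_residues a by simp
    then obtain y where "resA a = resQ y" "y \<in> refine n G" by (rule imageE)
    then have y: "y \<in> refine n G" "resQ y = resA a" by auto
    have yc: "y \<in> carrier Q" using y refine_subset G_carrier by blast
    have "resA (a \<oplus>\<^bsub>A\<^esub> \<ominus>\<^bsub>A\<^esub> fst y) = \<zero>\<^bsub>k\<^esub>" using a yc y by (simp add: resQ_def k.r_neg)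
    then have "a \<oplus>\<^bsub>A\<^esub> \<ominus>\<^bsub>A\<^esub> fst y \<in> max_ideal p A" using kerA[of "a \<oplus>\<^bsub>A\<^esub> \<ominus>\<^bsub>A\<^esub> fst y"] a yc by simp
    then obtain b where b: "b \<in> carrier A" "a \<oplus>\<^bsub>A\<^esub> \<ominus>\<^bsub>A\<^esub> fst y = pelem p A \<otimes>\<^bsub>A\<^esub> b"
      by (auto simp: A.max_ideal_iff)
    obtain x where "b = fst x" "x \<in> G" using b(1) unfolding G_fst[symmetric] by (rule imageE)
    then have x: "x \<in> G" "fst x = b" by auto
    have xc: "x \<in> carrier Q" using x G_carrier by blast
    have "P \<otimes>\<^bsub>Q\<^esub> x \<oplus>\<^bsub>Q\<^esub> y \<in> refine n G"
      using err_in_refine[OF P_mult_err_ideal[OF x(1)]] y subringE(7)[OF refine_subring] by blast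
    moreover have "a = fst (P \<otimes>\<^bsub>Q\<^esub> x \<oplus>\<^bsub>Q\<^esub> y)"
    proof -
      have "fst (P \<otimes>\<^bsub>Q\<^esub> x \<oplus>\<^bsub>Q\<^esub> y) = (a \<oplus>\<^bsub>A\<^esub> \<ominus>\<^bsub>A\<^esub> fst y) \<oplus>\<^bsub>A\<^esub> fst y"
        unfolding b(2) using xc yc x by (simp add: fst_P)
      also have "\<dots> = a" using a yc by (simp add: A.a_assoc A.l_neg)
      finally show ?thesis by simp
    qed
    ultimately show "a \<in> fst ` refine n G" by (intro image_eqI)
  qed
  fix x assume x: "x \<in> refine n G" "fst x \<in> padic_ideal p A (Suc n)"
  have xG: "x \<in> G" using x refine_subset by blast
  have xc: "x \<in> carrier Q" using xG G_carrier by blast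
  obtain a where a: "a \<in> carrier A" "fst x = pelem p A [^]\<^bsub>A\<^esub> Suc n \<otimes>\<^bsub>A\<^esub> a"
    using x(2) by (auto simp: A.padic_ideal_iff)
  show "snd x \<in> padic_ideal p B (Suc n)"
  proof (cases "pelem p A [^]\<^bsub>A\<^esub> n = \<zero>\<^bsub>A\<^esub>")
    case True
    have "fst x \<in> padic_ideal p A n"
      unfolding A.padic_ideal_iff using a True by (intro bexI[of _ "\<zero>\<^bsub>A\<^esub>"]) auto
    then have "snd x \<in> padic_ideal p B n" using G_fun[OF xG] by blast
    then have "snd x = \<zero>\<^bsub>B\<^esub>" using char_B[OF True] by (auto simp: B.padic_ideal_iff)
    then show ?thesis unfolding B.padic_ideal_iff by (intro bexI[of _ "\<zero>\<^bsub>B\<^esub>"]) auto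
  next
    case False
    \<comment> \<open>Residue zero places \<open>x\<close> in the error ideal. Cancelling one
      \<open>p\<close> in the first component puts \<open>fst y\<close> into \<open>p^n A\<close>,
      and level \<open>n\<close> then gives the same for \<open>snd y\<close> in
      \<open>B\<close>.\<close>
    have "resQ x = \<zero>\<^bsub>k\<^esub>" unfolding resQ_def a(2) using a(1) by (simp add: res_pelem)
    then obtain y q where y: "y \<in> G" "q \<in> carrier Q" "x = P \<otimes>\<^bsub>Q\<^esub> y \<oplus>\<^bsub>Q\<^esub> P [^]\<^bsub>Q\<^esub> Suc n \<otimes>\<^bsub>Q\<^esub> q"
      using refine_ker[OF x(1)] unfolding err_ideal_def by blast
    have yc: "y \<in> carrier Q" using y G_carrier by blast
    have Pc: "P [^]\<^bsub>Q\<^esub> Suc n \<in> carrier Q" by (rule Q.nat_pow_closed) simp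
    let ?p = "pelem p A [^]\<^bsub>A\<^esub> Suc n"
    have pc: "?p \<in> carrier A" by (rule A.nat_pow_closed) simp
    have "fst x = pelem p A \<otimes>\<^bsub>A\<^esub> fst y \<oplus>\<^bsub>A\<^esub> ?p \<otimes>\<^bsub>A\<^esub> fst q"
      unfolding y(3) using yc y(2) Pc by (simp add: fst_P fst_P_pow del: nat_pow_Suc)
    then have "pelem p A \<otimes>\<^bsub>A\<^esub> fst y = ?p \<otimes>\<^bsub>A\<^esub> a \<oplus>\<^bsub>A\<^esub> \<ominus>\<^bsub>A\<^esub> (?p \<otimes>\<^bsub>A\<^esub> fst q)"
      unfolding a(2) using yc y(2) pc a(1) by (simp add: A.a_assoc A.r_neg del: nat_pow_Suc)
    also have "\<dots> = ?p \<otimes>\<^bsub>A\<^esub> (a \<oplus>\<^bsub>A\<^esub> \<ominus>\<^bsub>A\<^esub> fst q)"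
      using y(2) pc a(1) by (simp add: A.r_distr A.r_minus del: nat_pow_Suc)
    finally have "fst y \<in> padic_ideal p A n"
      using yc y(2) a(1) by (intro A.pelem_cancel[OF unitsA one_notin_max_ideal False]) auto
    then obtain b where b: "b \<in> carrier B" "snd y = pelem p B [^]\<^bsub>B\<^esub> n \<otimes>\<^bsub>B\<^esub> b"
      using G_fun[OF y(1)] by (auto simp: B.padic_ideal_iff)
    have "snd x = pelem p B \<otimes>\<^bsub>B\<^esub> snd y \<oplus>\<^bsub>B\<^esub> pelem p B [^]\<^bsub>B\<^esub> Suc n \<otimes>\<^bsub>B\<^esub> snd q"
      unfolding y(3) using yc y(2) Pc by (simp add: snd_P snd_P_pow del: nat_pow_Suc)
    also have "\<dots> = pelem p B [^]\<^bsub>B\<^esub> Suc n \<otimes>\<^bsub>B\<^esub> (b \<oplus>\<^bsub>B\<^esub> snd q)"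
      unfolding b(2) using b(1) y(2) by (simp add: B.r_distr B.l_distr B.m_ac)
    finally show ?thesis unfolding B.padic_ideal_iff using b(1) y(2) by (intro bexI[of _ "b \<oplus>\<^bsub>B\<^esub> snd q"]) auto
  qed
qed

end

section \<open>Passage to the intersection of all approximations\<close>

context lifting_data
begin

text \<open>The index is shifted by one: \<open>approx n\<close> has level \<open>Suc n\<close>,
  since the fibre product starts at level 1.\<close>

primrec approx :: "nat \<Rightarrow> ('a \<times> 'c) set" where
  "approx 0 = fiber_product"
| "approx (Suc n) = refine (Suc n) (approx n)"

lemma level_approx: "level (Suc n) (approx n)"
proof (induction n)
  case 0
  then show ?case using level_fiber_product by simp
next
  case (Suc n)
  interpret lifting_level A B k l resA resB Phi p T1 T2 D s "Suc n" "approx n"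
    using Suc by unfold_locales auto
  show ?case using refine_level by simp
qed

lemma lifting_level_approx:
  "lifting_level A B k l resA resB Phi p T1 T2 D s (Suc n) (approx n)"
  using level_approx by unfold_locales auto

lemma approx_antimono: "m \<le> n \<Longrightarrow> approx n \<subseteq> approx m"
proof (induction n)
  case (Suc n)
  then show ?case
    using lifting_level.refine_subset[OF lifting_level_approx[of n]] by (auto simp: le_Suc_eq)
qed simp

lemma approx_contains:
  assumes H: "subring H Q" "H \<subseteq> fiber_product"
    and div: "\<And>h. h \<in> H \<Longrightarrow> resQ h = \<zero>\<^bsub>k\<^esub> \<Longrightarrow> \<exists>h'\<in>H. h = P \<otimes>\<^bsub>Q\<^esub> h'"
    and gen: "\<And>Y. subring Y k \<Longrightarrow> (\<And>h. h \<in> H \<Longrightarrow> resQ h [^]\<^bsub>k\<^esub> p \<in> Y) \<Longrightarrow>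
      (\<And>t. t \<in> T1 \<union> T2 \<Longrightarrow> s t \<in> H \<Longrightarrow> t \<in> Y) \<Longrightarrow> resQ ` H \<subseteq> Y"
  shows "H \<subseteq> approx n"
proof (induction n)
  case (Suc n)
  show ?case unfolding approx.simps
    by (rule lifting_level.refine_contains[OF lifting_level_approx H(1) Suc.IH div gen])
qed (use H in simp)

lemma padic_ideal_Suc: "padic_ideal p B (Suc n) \<subseteq> padic_ideal p B n"
proof
  fix x assume "x \<in> padic_ideal p B (Suc n)"
  then obtain z where "z \<in> carrier B" "x = pelem p B [^]\<^bsub>B\<^esub> n \<otimes>\<^bsub>B\<^esub> (pelem p B \<otimes>\<^bsub>B\<^esub> z)"
    by (auto simp: B.padic_ideal_iff B.m_assoc)
  then show "x \<in> padic_ideal p B n"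
    unfolding B.padic_ideal_iff by (intro bexI[of _ "pelem p B \<otimes>\<^bsub>B\<^esub> z"]) auto
qed

lemma Q_diff:
  assumes "u \<in> carrier Q" "v \<in> carrier Q"
  shows "fst (u \<oplus>\<^bsub>Q\<^esub> \<ominus>\<^bsub>Q\<^esub> v) = fst u \<oplus>\<^bsub>A\<^esub> \<ominus>\<^bsub>A\<^esub> fst v"
    and "snd (u \<oplus>\<^bsub>Q\<^esub> \<ominus>\<^bsub>Q\<^esub> v) = snd u \<oplus>\<^bsub>B\<^esub> \<ominus>\<^bsub>B\<^esub> snd v"
  using assms by simp_all

text \<open>The difference of the two pairs has first component zero, to which the graph condition
  of level \<open>Suc n\<close> applies.\<close>

lemma approx_diff:
  assumes "(x, y) \<in> approx n" "(x, y') \<in> approx n"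
  shows "y \<ominus>\<^bsub>B\<^esub> y' \<in> padic_ideal p B (Suc n)"
proof -
  interpret lifting_level A B k l resA resB Phi p T1 T2 D s "Suc n" "approx n"
    by (rule lifting_level_approx)
  have c: "(x, y) \<in> carrier Q" "(x, y') \<in> carrier Q" using assms G_carrier by blast+
  let ?d = "(x, y) \<oplus>\<^bsub>Q\<^esub> \<ominus>\<^bsub>Q\<^esub> (x, y')"
  have d: "?d \<in> approx n" using assms G_mem by blast
  have "fst ?d = \<zero>\<^bsub>A\<^esub>" unfolding Q_diff(1)[OF c] using c by (simp add: A.r_neg carrier_Q)
  then have "fst ?d \<in> padic_ideal p A (Suc n)"
    unfolding A.padic_ideal_iff by (intro bexI[of _ "\<zero>\<^bsub>A\<^esub>"]) auto
  then have "snd ?d \<in> padic_ideal p B (Suc n)" by (rule G_fun[OF d])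
  moreover have "snd ?d = y \<ominus>\<^bsub>B\<^esub> y'"
    unfolding Q_diff(2)[OF c] by (simp add: B.minus_eq)
  ultimately show ?thesis by simp
qed

text \<open>Separatedness of \<open>B\<close> in its \<open>p\<close>-adic topology makes the
  intersection single-valued.\<close>

lemma approx_unique:
  assumes "\<And>n. (x, y) \<in> approx n" "\<And>n. (x, y') \<in> approx n"
  shows "y = y'"
proof -
  have c: "y \<in> carrier B" "y' \<in> carrier B"
    using assms[of 0] by (auto simp: fiber_product_def carrier_Q)
  have "y \<ominus>\<^bsub>B\<^esub> y' \<in> padic_ideal p B n" for n
    using approx_diff[OF assms] padic_ideal_Suc by blast
  then have "y \<ominus>\<^bsub>B\<^esub> y' = \<zero>\<^bsub>B\<^esub>" using complete c unfolding padic_complete_def by simp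
  then show ?thesis using c by simp
qed

text \<open>Second components chosen at the successive levels form a Cauchy sequence by
  \<open>approx_diff\<close>. Its limit stays in each approximation because \<open>approx n\<close>
  contains all multiples of \<open>P [^] Suc n\<close>.\<close>

lemma approx_limit:
  assumes x: "x \<in> carrier A"
  shows "\<exists>y\<in>carrier B. \<forall>n. (x, y) \<in> approx n"
proof -
  have "\<exists>y. (x, y) \<in> approx n" for n
  proof -
    have "x \<in> fst ` approx n" unfolding lifting_level.G_fst[OF lifting_level_approx] by (rule x)
    then obtain u where "x = fst u" "u \<in> approx n" by (rule imageE)
    then show ?thesis by (intro exI[of _ "snd u"]) simp
  qed
  then obtain y where y: "\<And>n. (x, y n) \<in> approx n" using choice[of "\<lambda>n y. (x, y) \<in> approx n"] by blast
  have yc: "y n \<in> carrier B" for n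
    using y[of n] approx_antimono[of 0 n] by (auto simp: fiber_product_def carrier_Q)
  have cauchy: "\<exists>M. \<forall>m\<ge>M. \<forall>n\<ge>M. y m \<ominus>\<^bsub>B\<^esub> y n \<in> padic_ideal p B N" for N
  proof (intro exI[of _ N] allI impI)
    fix m n assume "N \<le> m" "N \<le> n"
    then have "(x, y m) \<in> approx N" "(x, y n) \<in> approx N" using y approx_antimono by blast+
    then show "y m \<ominus>\<^bsub>B\<^esub> y n \<in> padic_ideal p B N" using approx_diff padic_ideal_Suc by blast
  qed
  obtain b where b: "b \<in> carrier B" "\<forall>N. \<exists>M. \<forall>n\<ge>M. y n \<ominus>\<^bsub>B\<^esub> b \<in> padic_ideal p B N"
    using complete[unfolded padic_complete_def, THEN conjunct2, rule_format, of y, OF yc cauchy] by blast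
  have "(x, b) \<in> approx n" for n
  proof -
    interpret lifting_level A B k l resA resB Phi p T1 T2 D s "Suc n" "approx n"
      by (rule lifting_level_approx)
    obtain M where M: "\<And>m. m \<ge> M \<Longrightarrow> y m \<ominus>\<^bsub>B\<^esub> b \<in> padic_ideal p B (Suc n)"
      using b(2)[rule_format, of "Suc n"] by blast
    \<comment> \<open>The bound \<open>M\<close> makes \<open>y ?m\<close> close to the limit, and
      the bound \<open>n\<close> puts its pair into \<open>approx n\<close>.\<close>
    let ?m = "max M n"
    have xy: "(x, y ?m) \<in> approx n" using y approx_antimono[of n ?m] by auto
    obtain c where c: "c \<in> carrier B" "y ?m \<ominus>\<^bsub>B\<^esub> b = pelem p B [^]\<^bsub>B\<^esub> Suc n \<otimes>\<^bsub>B\<^esub> c"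
      using M[of ?m] by (auto simp: B.padic_ideal_iff simp del: nat_pow_Suc)
    \<comment> \<open>The zero first component makes the correction change only the second
      coordinate.\<close>
    have q: "(\<zero>\<^bsub>A\<^esub>, c) \<in> carrier Q" using c by (simp add: carrier_Q)
    let ?q = "P [^]\<^bsub>Q\<^esub> Suc n \<otimes>\<^bsub>Q\<^esub> (\<zero>\<^bsub>A\<^esub>, c)"
    have Pc: "P [^]\<^bsub>Q\<^esub> Suc n \<in> carrier Q" by (rule Q.nat_pow_closed) simp
    have pc: "pelem p A [^]\<^bsub>A\<^esub> Suc n \<in> carrier A" by (rule A.nat_pow_closed) simp
    have qc: "?q \<in> carrier Q" using q Pc by blast
    have q2: "fst ?q = \<zero>\<^bsub>A\<^esub>" "snd ?q = y ?m \<ominus>\<^bsub>B\<^esub> b"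
      unfolding f.hom_mult[OF Pc q] g.hom_mult[OF Pc q] fst_P_pow snd_P_pow fst_conv snd_conv c(2)
      using A.r_null[OF pc] by simp_all
    have xyc: "(x, y ?m) \<in> carrier Q" using x yc by (simp add: carrier_Q)
    have "(x, b) = (x, y ?m) \<oplus>\<^bsub>Q\<^esub> \<ominus>\<^bsub>Q\<^esub> ?q"
    proof (rule prod_eqI)
      show "fst (x, b) = fst ((x, y ?m) \<oplus>\<^bsub>Q\<^esub> \<ominus>\<^bsub>Q\<^esub> ?q)"
        unfolding Q_diff(1)[OF xyc qc] q2 using x by simp
      have "snd ((x, y ?m) \<oplus>\<^bsub>Q\<^esub> \<ominus>\<^bsub>Q\<^esub> ?q) = y ?m \<oplus>\<^bsub>B\<^esub> \<ominus>\<^bsub>B\<^esub> (y ?m \<ominus>\<^bsub>B\<^esub> b)"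
        unfolding Q_diff(2)[OF xyc qc] q2 by simp
      also have "\<dots> = b" using yc[of ?m] b(1) by (simp add: B.minus_eq B.minus_add B.r_neg2)
      finally show "snd (x, b) = snd ((x, y ?m) \<oplus>\<^bsub>Q\<^esub> \<ominus>\<^bsub>Q\<^esub> ?q)" by simp
    qed
    moreover have "(x, y ?m) \<oplus>\<^bsub>Q\<^esub> \<ominus>\<^bsub>Q\<^esub> ?q \<in> approx n"
      by (intro G_mem(5) G_mem(3) xy G_pow[OF q])
    ultimately show ?thesis by simp
  qed
  then show ?thesis using b(1) by blast
qed

text \<open>Every approximation is a subring, so sums, products and the unit of the graph lie in all
  of them; \<open>approx_unique\<close> turns this into the homomorphism laws.\<close>

lemma exists_lift:
  "\<exists>f\<in>ring_hom A B. \<forall>x\<in>carrier A. \<forall>n. (x, f x) \<in> approx n"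
proof -
  obtain f where f: "\<And>x. x \<in> carrier A \<Longrightarrow> f x \<in> carrier B \<and> (\<forall>n. (x, f x) \<in> approx n)"
    using approx_limit by metis
  have sub: "subring (approx n) Q" for n by (rule lifting_level.G_subring[OF lifting_level_approx])
  have "f \<in> ring_hom A B"
  proof (rule ring_hom_memI)
    fix x assume x: "x \<in> carrier A"
    then show "f x \<in> carrier B" using f by blast
    fix y assume y: "y \<in> carrier A"
    have "(x \<otimes>\<^bsub>A\<^esub> y, f x \<otimes>\<^bsub>B\<^esub> f y) \<in> approx n" for n
      using subringE(6)[OF sub, of "(x, f x)" n "(y, f y)"] f x y by (simp add: RDirProd_simps)
    then show "f (x \<otimes>\<^bsub>A\<^esub> y) = f x \<otimes>\<^bsub>B\<^esub> f y" using f x y by (intro approx_unique) auto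
    have "(x \<oplus>\<^bsub>A\<^esub> y, f x \<oplus>\<^bsub>B\<^esub> f y) \<in> approx n" for n
      using subringE(7)[OF sub, of "(x, f x)" n "(y, f y)"] f x y by (simp add: RDirProd_simps)
    then show "f (x \<oplus>\<^bsub>A\<^esub> y) = f x \<oplus>\<^bsub>B\<^esub> f y" using f x y by (intro approx_unique) auto
  next
    have "(\<one>\<^bsub>A\<^esub>, \<one>\<^bsub>B\<^esub>) \<in> approx n" for n
      using subringE(3)[OF sub, of n] by (simp add: RDirProd_simps)
    then show "f \<one>\<^bsub>A\<^esub> = \<one>\<^bsub>B\<^esub>" using f by (intro approx_unique) auto
  qed
  then show ?thesis using f by blast
qed

text \<open>Instance of \<open>approx_contains\<close> for the graph of \<open>psi\<close> over a
  subring \<open>A1\<close>. It serves both the extension property, with the given morphism on the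
  small ring, and uniqueness, with a competing lift on all of \<open>A\<close>.\<close>

lemma graph_in_approx:
  assumes A1: "subring A1 A" and psi: "psi \<in> ring_hom (A\<lparr>carrier := A1\<rparr>) B"
    and res: "\<And>x. x \<in> A1 \<Longrightarrow> Phi (resA x) = resB (psi x)"
    and div: "\<And>x. x \<in> A1 \<Longrightarrow> resA x = \<zero>\<^bsub>k\<^esub> \<Longrightarrow> \<exists>y\<in>A1. x = pelem p A \<otimes>\<^bsub>A\<^esub> y"
    and gen: "\<And>Y. subring Y k \<Longrightarrow> (\<And>x. x \<in> A1 \<Longrightarrow> resA x [^]\<^bsub>k\<^esub> p \<in> Y) \<Longrightarrow>
      (\<And>t. t \<in> T1 \<union> T2 \<Longrightarrow> fst (s t) \<in> A1 \<Longrightarrow> psi (fst (s t)) = snd (s t) \<Longrightarrow> t \<in> Y) \<Longrightarrow> resA ` A1 \<subseteq> Y"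
    and x: "x \<in> A1"
  shows "(x, psi x) \<in> approx n"
proof -
  have A1c: "a \<in> carrier A" if "a \<in> A1" for a using that subringE(1)[OF A1] by blast
  have psic: "psi a \<in> carrier B" if "a \<in> A1" for a using ring_hom_closed[OF psi] that by simp
  interpret R: ring "A\<lparr>carrier := A1\<rparr>" by (rule A.subring_is_ring[OF A1])
  interpret gr: ring_hom_ring "A\<lparr>carrier := A1\<rparr>" Q "\<lambda>a. (a, psi a)"
  proof (intro ring_hom_ringI2 R.ring_axioms Q.ring_axioms ring_hom_memI)
    fix a b assume ab: "a \<in> carrier (A\<lparr>carrier := A1\<rparr>)" "b \<in> carrier (A\<lparr>carrier := A1\<rparr>)"
    show "(a \<otimes>\<^bsub>A\<lparr>carrier := A1\<rparr>\<^esub> b, psi (a \<otimes>\<^bsub>A\<lparr>carrier := A1\<rparr>\<^esub> b)) = (a, psi a) \<otimes>\<^bsub>Q\<^esub> (b, psi b)"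
      using ring_hom_mult[OF psi ab] by (simp add: RDirProd_simps)
    show "(a \<oplus>\<^bsub>A\<lparr>carrier := A1\<rparr>\<^esub> b, psi (a \<oplus>\<^bsub>A\<lparr>carrier := A1\<rparr>\<^esub> b)) = (a, psi a) \<oplus>\<^bsub>Q\<^esub> (b, psi b)"
      using ring_hom_add[OF psi ab] by (simp add: RDirProd_simps)
  qed (use A1c psic ring_hom_one[OF psi] in \<open>simp_all add: carrier_Q RDirProd_simps\<close>)
  let ?H = "(\<lambda>a. (a, psi a)) ` A1"
  have "?H \<subseteq> approx n"
  proof (rule approx_contains)
    show "subring ?H Q" using gr.img_is_subring[OF R.carrier_is_subring] by simp
    show "?H \<subseteq> fiber_product" using A1c psic res by (auto simp: fiber_product_def carrier_Q)
  next
    fix h assume "h \<in> ?H" and h0: "resQ h = \<zero>\<^bsub>k\<^esub>"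
    then obtain a where a: "h = (a, psi a)" "a \<in> A1" by blast
    then obtain b where b: "b \<in> A1" "a = pelem p A \<otimes>\<^bsub>A\<^esub> b" using div[OF a(2)] h0 by (auto simp: resQ_def)
    have pA1: "pelem p A \<in> A1" using R.pelem_closed[of p] by (simp add: A.pelem_subring)
    have "psi (pelem p A) = pelem p B"
      using pelem_hom[OF psi R.ring_axioms B.ring_axioms, of p] by (simp add: A.pelem_subring)
    then have "psi a = pelem p B \<otimes>\<^bsub>B\<^esub> psi b" unfolding b(2) using ring_hom_mult[OF psi, of "pelem p A" b] pA1 b(1) by simp
    moreover have "P = (pelem p A, pelem p B)" using fst_P snd_P by (metis prod.collapse)
    ultimately have "h = P \<otimes>\<^bsub>Q\<^esub> (b, psi b)" unfolding a(1) b(2)[symmetric] using b(2) by (simp add: RDirProd_simps)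
    then show "\<exists>h'\<in>?H. h = P \<otimes>\<^bsub>Q\<^esub> h'" using b(1) by blast
  next
    fix Y assume Y: "subring Y k" "\<And>h. h \<in> ?H \<Longrightarrow> resQ h [^]\<^bsub>k\<^esub> p \<in> Y"
      "\<And>t. t \<in> T1 \<union> T2 \<Longrightarrow> s t \<in> ?H \<Longrightarrow> t \<in> Y"
    have "resA ` A1 \<subseteq> Y"
    proof (rule gen[OF Y(1)])
      show "resA a [^]\<^bsub>k\<^esub> p \<in> Y" if "a \<in> A1" for a
        using Y(2)[of "(a, psi a)"] that by (simp add: resQ_def)
      show "t \<in> Y" if "t \<in> T1 \<union> T2" "fst (s t) \<in> A1" "psi (fst (s t)) = snd (s t)" for t
      proof (rule Y(3)[OF that(1)])
        show "s t \<in> ?H" by (rule image_eqI[OF _ that(2)]) (simp add: that(3))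
      qed
    qed
    then show "resQ ` ?H \<subseteq> Y" by (auto simp: resQ_def)
  qed
  then show ?thesis using x by blast
qed

end

section \<open>Lifting morphisms of Cohen rings\<close>

theorem theorem7p1:
  fixes p :: nat
    and A2 :: "('a, 'm) ring_scheme" and k2 :: "('b, 'n) ring_scheme"
    and A1 :: "'a set" and k1 :: "'b set" and resA1 resA2 :: "'a \<Rightarrow> 'b"
    and B2 :: "('c, 'o) ring_scheme" and l2 :: "('d, 'q) ring_scheme"
    and B1 :: "'c set" and l1 :: "'d set" and resB1 resB2 :: "'c \<Rightarrow> 'd"
    and phiA :: "'a \<Rightarrow> 'c" and phik :: "'b \<Rightarrow> 'd" and Phik :: "'b \<Rightarrow> 'd"
    and beta :: "'b set" and sA :: "'b \<Rightarrow> 'a" and sB :: "'d \<Rightarrow> 'c"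
  assumes "Factorial_Ring.prime p"
    and "cohen_ext p A1 k1 resA1 A2 k2 resA2"
    and "cohen_ext p B1 l1 resB1 B2 l2 resB2"
    and "separable_ext p k2 k1"
    and "cohen_morphism p (A2\<lparr>carrier := A1\<rparr>) (k2\<lparr>carrier := k1\<rparr>) resA1
                          (B2\<lparr>carrier := B1\<rparr>) (l2\<lparr>carrier := l1\<rparr>) resB1 phiA phik"
    and "Phik \<in> ring_hom k2 l2"
    and "\<forall>x\<in>k1. Phik x = phik x"
    and "separable_ext p l2 (Phik ` carrier k2)"
    and "p_basis_over p k2 k1 beta"
    and "\<forall>b\<in>beta. sA b \<in> carrier A2 \<and> resA2 (sA b) = b"
    and "\<forall>c\<in>Phik ` beta. sB c \<in> carrier B2 \<and> resB2 (sB c) = c"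
  shows "\<exists>PhiA. cohen_morphism p A2 k2 resA2 B2 l2 resB2 PhiA Phik \<and>
           (\<forall>b\<in>beta. PhiA (sA b) = sB (Phik b)) \<and>
           (\<forall>x\<in>A1. PhiA x = phiA x) \<and>
           (\<forall>Psi. cohen_morphism p A2 k2 resA2 B2 l2 resB2 Psi Phik \<and>
                 (\<forall>b\<in>beta. Psi (sA b) = sB (Phik b)) \<and>
                 (\<forall>x\<in>A1. Psi x = phiA x)
                 \<longrightarrow> (\<forall>x\<in>carrier A2. Psi x = PhiA x))"
proof -
  note p = assms(1)
  have cA2: "cohen_ring p A2 k2 resA2" and sA1: "subring A1 A2" and sk1: "subfield k1 k2"
    and cA1: "cohen_ring p (A2\<lparr>carrier := A1\<rparr>) (k2\<lparr>carrier := k1\<rparr>) resA1"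
    and mA: "cohen_morphism p (A2\<lparr>carrier := A1\<rparr>) (k2\<lparr>carrier := k1\<rparr>) resA1 A2 k2 resA2 id id"
    using assms(2) unfolding cohen_ext_def by auto
  have cB2: "cohen_ring p B2 l2 resB2" and sB1: "subring B1 B2" and sl1: "subfield l1 l2"
    and cB1: "cohen_ring p (B2\<lparr>carrier := B1\<rparr>) (l2\<lparr>carrier := l1\<rparr>) resB1"
    and mB: "cohen_morphism p (B2\<lparr>carrier := B1\<rparr>) (l2\<lparr>carrier := l1\<rparr>) resB1 B2 l2 resB2 id id"
    using assms(3) unfolding cohen_ext_def by auto
  interpret A: cring A2 using cA2 by (simp add: cohen_ring_def)
  interpret B: cring B2 using cB2 by (simp add: cohen_ring_def)
  interpret k: field k2 using cA2 by (simp add: cohen_ring_def)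
  interpret l: field l2 using cB2 by (simp add: cohen_ring_def)
  interpret A1: cring "A2\<lparr>carrier := A1\<rparr>" using cA1 by (simp add: cohen_ring_def)
  interpret B1: cring "B2\<lparr>carrier := B1\<rparr>" using cB1 by (simp add: cohen_ring_def)
  interpret k1: field "k2\<lparr>carrier := k1\<rparr>" using cA1 by (simp add: cohen_ring_def)
  interpret rA: ring_hom_ring A2 k2 resA2
    using cA2 by (intro ring_hom_ringI2 A.ring_axioms k.ring_axioms) (simp add: cohen_ring_def)
  interpret rB: ring_hom_ring B2 l2 resB2
    using cB2 by (intro ring_hom_ringI2 B.ring_axioms l.ring_axioms) (simp add: cohen_ring_def)
  interpret ph: ring_hom_ring k2 l2 Phik
    using assms(6) by (intro ring_hom_ringI2 k.ring_axioms l.ring_axioms)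
  interpret fA: ring_hom_ring "A2\<lparr>carrier := A1\<rparr>" "B2\<lparr>carrier := B1\<rparr>" phiA
    using assms(5) by (intro ring_hom_ringI2 A1.ring_axioms B1.ring_axioms) (simp add: cohen_morphism_def)
  have A1c: "a \<in> carrier A2" if "a \<in> A1" for a using that subringE(1)[OF sA1] by blast
  have B1c: "b \<in> carrier B2" if "b \<in> B1" for b using that subringE(1)[OF sB1] by blast
  have k1c: "k1 \<subseteq> carrier k2" using subfieldE(3)[OF sk1] .
  have resA1: "resA1 a = resA2 a" if "a \<in> A1" for a using mA that by (simp add: cohen_morphism_def)
  have resB1: "resB1 b = resB2 b" if "b \<in> B1" for b using mB that by (simp add: cohen_morphism_def)
  have imA1: "resA2 ` A1 = k1" using cA1 resA1 by (simp add: cohen_ring_def)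
  have kerA: "resA2 x = \<zero>\<^bsub>k2\<^esub> \<longleftrightarrow> x \<in> max_ideal p A2" if "x \<in> carrier A2" for x
    using cA2 that unfolding cohen_ring_def by blast
  have kerB: "resB2 x = \<zero>\<^bsub>l2\<^esub> \<longleftrightarrow> x \<in> max_ideal p B2" if "x \<in> carrier B2" for x
    using cB2 that unfolding cohen_ring_def by blast
  have phiA: "phiA a \<in> B1" "resB2 (phiA a) = Phik (resA2 a)" if a: "a \<in> A1" for a
  proof -
    show mem: "phiA a \<in> B1" using fA.hom_closed[of a] a by simp
    have "resB1 (phiA a) = phik (resA1 a)" using assms(5) a by (simp add: cohen_morphism_def)
    moreover have "resA2 a \<in> k1" using imA1 a by blast
    ultimately show "resB2 (phiA a) = Phik (resA2 a)" using resA1[OF a] resB1[OF mem] assms(7) by simp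
  qed
  have char: "pelem p k2 = \<zero>\<^bsub>k2\<^esub>"
  proof -
    have "pelem p A2 \<in> max_ideal p A2" unfolding A.max_ideal_iff by (rule bexI[of _ "\<one>\<^bsub>A2\<^esub>"]) auto
    then show ?thesis
      using pelem_hom[OF rA.homh A.ring_axioms k.ring_axioms, of p] kerA[of "pelem p A2"] by simp
  qed
  obtain gamma where gamma: "p_basis_over p (k2\<lparr>carrier := k1\<rparr>) {} gamma"
    using k1.exists_p_basis_over[OF p, of "{}"] char by (auto simp: k.pelem_subring)
  have gamma_k1: "gamma \<subseteq> k1" using gamma by (simp add: p_basis_over_def p_indep_over_def)
  \<comment> \<open>Separability of the residue extension keeps a \<open>p\<close>-basis of
    \<open>k1\<close> independent over the \<open>p\<close>-th powers of \<open>k2\<close>.\<close>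
  have gamma_ind: "p_indep_over p k2 {} gamma"
    using assms(4) gamma gamma_k1 unfolding separable_ext_def p_basis_over_def by blast
  have beta_ind: "p_indep_over p k2 k1 beta" using assms(9) by (simp add: p_basis_over_def)
  have beta_c: "beta \<subseteq> carrier k2" using beta_ind by (simp add: p_indep_over_def)
  let ?kp = "{x [^]\<^bsub>k2\<^esub> p | x. x \<in> carrier k2}"
  have kp: "?kp \<subseteq> carrier k2" "?kp \<union> k1 \<subseteq> carrier k2" using k1c by auto
  have ind1: "t \<notin> generate_field k2 (?kp \<union> S)"
    if S: "finite S" "S \<subseteq> gamma" and t: "t \<in> gamma - S" for S t
  proof -
    have Sc: "S \<subseteq> carrier k2" using S(2) gamma_k1 k1c by blast
    have "t \<notin> generate_field k2 (pbase p k2 {} \<union> S)"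
      by (rule k.p_indep_over_not_mem[OF p _ gamma_ind S t]) simp
    then show ?thesis using k.generate_field_union_generate[OF kp(1) Sc] by (simp add: pbase_def)
  qed
  have ind2: "t \<notin> generate_field k2 ((?kp \<union> k1) \<union> S)"
    if S: "finite S" "S \<subseteq> beta" and t: "t \<in> beta - S" for S t
  proof -
    have Sc: "S \<subseteq> carrier k2" using S(2) beta_c by blast
    have "t \<notin> generate_field k2 (pbase p k2 k1 \<union> S)"
      by (rule k.p_indep_over_not_mem[OF p k1c beta_ind S t])
    then show ?thesis using k.generate_field_union_generate[OF kp(2) Sc] by (simp add: pbase_def)
  qed
  \<comment> \<open>By \<open>ind2\<close> for the empty set, elements of \<open>beta\<close> lie
    outside \<open>k1\<close>. Hence the case distinction defining \<open>s\<close> never overrides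
    the prescribed values on \<open>beta\<close>.\<close>
  have disj: "t \<notin> gamma" if "t \<in> beta" for t
    using ind2[of "{}" t] that gamma_k1 by (auto intro: generate_field.incl)
  \<comment> \<open>Intersecting with \<open>k1\<close> gives a subring of \<open>k1\<close> that
    contains its \<open>p\<close>-th powers and its \<open>p\<close>-basis
    \<open>gamma\<close>.\<close>
  have full1: "k1 \<subseteq> Y" if Y: "subring Y k2" "\<And>x. x \<in> k1 \<Longrightarrow> x [^]\<^bsub>k2\<^esub> p \<in> Y" "gamma \<subseteq> Y" for Y
  proof -
    have pow: "x [^]\<^bsub>k2\<^esub> (m::nat) \<in> k1" if "x \<in> k1" for x m
      using that by (induction m) (auto simp: subringE(3,6)[OF subfieldE(1)[OF sk1]])
    have "subring (Y \<inter> k1) (k2\<lparr>carrier := k1\<rparr>)"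
      by (intro k.subring_in_subring k.subring_inter Y(1) subfieldE(1)[OF sk1]) blast
    then have "Y \<inter> k1 = carrier (k2\<lparr>carrier := k1\<rparr>)"
      using Y pow gamma_k1
      by (intro k1.subring_containing_p_basis[OF p gamma]) (auto simp: k.nat_pow_consistent[symmetric])
    then show ?thesis by auto
  qed
  have full: "Y = carrier k2"
    if Y: "subring Y k2" "\<And>x. x \<in> carrier k2 \<Longrightarrow> x [^]\<^bsub>k2\<^esub> p \<in> Y" "gamma \<union> beta \<subseteq> Y" for Y
  proof (rule k.subring_containing_p_basis[OF p assms(9) Y(1,2)])
    show "k1 \<subseteq> Y" using Y k1c by (intro full1) auto
  qed (use Y in auto)
  \<comment> \<open>The representatives of \<open>gamma\<close> are taken inside \<open>A1\<close>,
    so that \<open>phiA\<close> dictates their images.\<close>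
  have "\<exists>r. \<forall>t\<in>gamma. r t \<in> A1 \<and> resA2 (r t) = t"
    using gamma_k1 unfolding imA1[symmetric] by (intro bchoice) blast
  then obtain r where r: "\<And>t. t \<in> gamma \<Longrightarrow> r t \<in> A1" "\<And>t. t \<in> gamma \<Longrightarrow> resA2 (r t) = t" by blast
  define s where "s t = (if t \<in> gamma then (r t, phiA (r t)) else (sA t, sB (Phik t)))" for t
  have s_gamma: "s t = (r t, phiA (r t))" if "t \<in> gamma" for t using that by (simp add: s_def)
  have s_beta: "s t = (sA t, sB (Phik t))" if "t \<in> beta" for t using disj[OF that] by (simp add: s_def)
  interpret L: lifting_data A2 B2 k2 l2 resA2 resB2 Phik p gamma beta "?kp \<union> k1" s
  proof
    show "Factorial_Ring.prime p" by (rule p)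
    show "resA2 ` carrier A2 = carrier k2" using cA2 by (simp add: cohen_ring_def)
    show "resB2 ` carrier B2 = carrier l2" using cB2 by (simp add: cohen_ring_def)
    show "padic_complete p B2" using cB2 by (simp add: cohen_ring_def)
    show "x \<in> Units A2" if "x \<in> carrier A2" "x \<notin> max_ideal p A2" for x
      using cA2 that by (simp add: cohen_ring_def)
    \<comment> \<open>The subrings share the element \<open>p\<close> with the large rings, so
      applying \<open>phiA\<close> transfers the vanishing.\<close>
    show "pelem p B2 [^]\<^bsub>B2\<^esub> n = \<zero>\<^bsub>B2\<^esub>" if "pelem p A2 [^]\<^bsub>A2\<^esub> n = \<zero>\<^bsub>A2\<^esub>" for n :: nat
    proof -
      have "phiA (pelem p A2 [^]\<^bsub>A2\<^esub> n) = pelem p B2 [^]\<^bsub>B2\<^esub> n"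
        using fA.hom_nat_pow[of "pelem p A2" n] A1.pelem_closed[of p]
          pelem_hom[OF fA.homh A1.ring_axioms B1.ring_axioms, of p]
        by (simp add: A.pelem_subring B.pelem_subring A.nat_pow_consistent[symmetric] B.nat_pow_consistent[symmetric])
      then show ?thesis using that fA.hom_zero by simp
    qed
    show "s t \<in> carrier A2 \<times> carrier B2 \<and> resA2 (fst (s t)) = t \<and> resB2 (snd (s t)) = Phik t"
      if "t \<in> gamma \<union> beta" for t
    proof (cases "t \<in> gamma")
      case True
      then show ?thesis using r[OF True] phiA[OF r(1)[OF True]] A1c B1c by (simp add: s_gamma)
    next
      case False
      then have "t \<in> beta" using that by blast
      then show ?thesis using assms(10,11) by (simp add: s_beta)
    qed
    show "?kp \<union> k1 \<subseteq> carrier k2" by (rule kp(2))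
    show "z [^]\<^bsub>k2\<^esub> p \<in> ?kp \<union> k1" if "z \<in> carrier k2" for z using that by blast
    show "gamma \<subseteq> ?kp \<union> k1" using gamma_k1 by blast
  qed (fact kerA kerB ind1 ind2 full)+
  obtain f where f: "f \<in> ring_hom A2 B2" "\<And>x n. x \<in> carrier A2 \<Longrightarrow> (x, f x) \<in> L.approx n"
    using L.exists_lift by blast
  have fc: "f x \<in> carrier B2" if "x \<in> carrier A2" for x using ring_hom_closed[OF f(1) that] .
  have f_res: "Phik (resA2 x) = resB2 (f x)" if "x \<in> carrier A2" for x
    using f(2)[OF that, of 0] by (simp add: L.fiber_product_def)
  have s_approx: "s t \<in> L.approx n" if "t \<in> gamma \<union> beta" for t n
    using lifting_level.G_s[OF L.lifting_level_approx[of n]] that by blast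
  have "f (sA b) = sB (Phik b)" if b: "b \<in> beta" for b
    using f(2)[of "sA b"] s_approx[of b] b assms(10) s_beta[OF b] by (intro L.approx_unique[of "sA b"]) auto
  moreover have "f x = phiA x" if x: "x \<in> A1" for x
  proof (rule L.approx_unique)
    show "(x, f x) \<in> L.approx n" for n using f(2) A1c[OF x] .
    \<comment> \<open>Over \<open>A1\<close> the representatives of \<open>gamma\<close> are
      available, and by \<open>full1\<close> they suffice to reach all residues in
      \<open>k1\<close>.\<close>
    show "(x, phiA x) \<in> L.approx n" for n
    proof (rule L.graph_in_approx[OF sA1 _ _ _ _ x])
      show "phiA \<in> ring_hom (A2\<lparr>carrier := A1\<rparr>) B2"
        using fA.homh B1c by (auto simp: ring_hom_def)
      show "Phik (resA2 a) = resB2 (phiA a)" if "a \<in> A1" for a using phiA(2)[OF that] by simp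
      show "\<exists>b\<in>A1. a = pelem p A2 \<otimes>\<^bsub>A2\<^esub> b" if "a \<in> A1" "resA2 a = \<zero>\<^bsub>k2\<^esub>" for a
      proof -
        \<comment> \<open>The inclusion being a morphism, \<open>max_ideal p A2\<close> meets
          \<open>A1\<close> in the maximal ideal of \<open>A1\<close>; this yields a quotient by
          \<open>p\<close> inside \<open>A1\<close>.\<close>
        have "a \<in> max_ideal p A2" using kerA[OF A1c[OF that(1)]] that(2) by simp
        then have "a \<in> max_ideal p (A2\<lparr>carrier := A1\<rparr>)"
          using mA that(1) unfolding cohen_morphism_def by auto
        then show ?thesis unfolding A1.max_ideal_iff by (simp add: A.pelem_subring)
      qed
      fix Y assume Y: "subring Y k2" "\<And>x. x \<in> A1 \<Longrightarrow> resA2 x [^]\<^bsub>k2\<^esub> p \<in> Y"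
        "\<And>t. t \<in> gamma \<union> beta \<Longrightarrow> fst (s t) \<in> A1 \<Longrightarrow> phiA (fst (s t)) = snd (s t) \<Longrightarrow> t \<in> Y"
      show "resA2 ` A1 \<subseteq> Y"
        unfolding imA1
      proof (rule full1[OF Y(1)])
        show "z [^]\<^bsub>k2\<^esub> p \<in> Y" if "z \<in> k1" for z using that Y(2) unfolding imA1[symmetric] by blast
        show "gamma \<subseteq> Y" using Y(3) r(1) by (auto simp: s_gamma)
      qed
    qed
  qed
  moreover have "cohen_morphism p A2 k2 resA2 B2 l2 resB2 f Phik"
    unfolding cohen_morphism_def
  proof (intro conjI ballI)
    \<comment> \<open>Compatibility with residues and injectivity of the field homomorphism
      \<open>Phik\<close> make \<open>f\<close> both preserve and reflect the maximal
      ideals.\<close>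
    have "f x \<in> max_ideal p B2 \<longleftrightarrow> x \<in> max_ideal p A2" if x: "x \<in> carrier A2" for x
    proof -
      have "resB2 (f x) = \<zero>\<^bsub>l2\<^esub> \<longleftrightarrow> resA2 x = \<zero>\<^bsub>k2\<^esub>"
        using inj_onD[OF non_trivial_field_hom_is_inj[OF ph.homh k.field_axioms l.field_axioms], of "resA2 x" "\<zero>\<^bsub>k2\<^esub>"] x
        unfolding f_res[OF x, symmetric] by auto
      then show ?thesis using kerA[OF x] kerB[OF fc[OF x]] by simp
    qed
    moreover have "max_ideal p A2 \<subseteq> carrier A2" by (auto simp: A.max_ideal_iff)
    ultimately show "{x \<in> carrier A2. f x \<in> max_ideal p B2} = max_ideal p A2" by blast
  qed (use f f_res assms(6) in auto)
  \<comment> \<open>The graph of any competitor also lies in every approximation, so it agrees with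
    that of \<open>f\<close>.\<close>
  moreover have "Psi x = f x"
    if Psi: "cohen_morphism p A2 k2 resA2 B2 l2 resB2 Psi Phik"
      "\<forall>b\<in>beta. Psi (sA b) = sB (Phik b)" "\<forall>x\<in>A1. Psi x = phiA x" and x: "x \<in> carrier A2" for Psi x
  proof (rule L.approx_unique)
    show "(x, f x) \<in> L.approx n" for n using f(2) x .
    show "(x, Psi x) \<in> L.approx n" for n
    proof (rule L.graph_in_approx[OF A.carrier_is_subring _ _ _ _ x])
      show "Psi \<in> ring_hom (A2\<lparr>carrier := carrier A2\<rparr>) B2" using Psi(1) by (simp add: cohen_morphism_def)
      show "Phik (resA2 a) = resB2 (Psi a)" if "a \<in> carrier A2" for a
        using Psi(1) that by (simp add: cohen_morphism_def)
      show "\<exists>b\<in>carrier A2. a = pelem p A2 \<otimes>\<^bsub>A2\<^esub> b" if "a \<in> carrier A2" "resA2 a = \<zero>\<^bsub>k2\<^esub>" for a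
        using kerA that by (simp add: A.max_ideal_iff)
      fix Y assume Y: "subring Y k2" "\<And>x. x \<in> carrier A2 \<Longrightarrow> resA2 x [^]\<^bsub>k2\<^esub> p \<in> Y"
        "\<And>t. t \<in> gamma \<union> beta \<Longrightarrow> fst (s t) \<in> carrier A2 \<Longrightarrow> Psi (fst (s t)) = snd (s t) \<Longrightarrow> t \<in> Y"
      have "Y = carrier k2"
      proof (rule full[OF Y(1)])
        show "z [^]\<^bsub>k2\<^esub> p \<in> Y" if "z \<in> carrier k2" for z
          using that Y(2) unfolding L.surjA[symmetric] by blast
        show "gamma \<union> beta \<subseteq> Y"
        proof
          fix t assume t: "t \<in> gamma \<union> beta"
          then have "fst (s t) \<in> carrier A2" using L.s[OF t] by auto
          moreover have "Psi (fst (s t)) = snd (s t)"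
          proof (cases "t \<in> gamma")
            case True
            then show ?thesis using Psi(3) r(1) by (simp add: s_gamma)
          next
            case False
            then show ?thesis using Psi(2) t by (auto simp: s_beta)
          qed
          ultimately show "t \<in> Y" using Y(3)[OF t] by blast
        qed
      qed
      then show "resA2 ` carrier A2 \<subseteq> Y" using L.surjA by simp
    qed
  qed
  ultimately show ?thesis by (intro exI[of _ f]) blast
qed

end
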